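(* Let $\ell\geq s\geq r\geq 3$ be integers. Then for all sufficiently large $n$, $$\mathrm{ex}_r(n,K_s^{(r)},K_{\ell+1}^r)=\mathcal{N}(K_s^{(r)},\mathcal{T}_r(n,\ell)).$$
   Context: An $r$-graph is a hypergraph all of whose hyperedges have exactly $r$ vertices. $K_s^{(r)}$ is the complete $r$-graph on $s$ vertices. For a graph $F$, the $r$-expansion $F^r$ is the $r$-graph obtained from $F$ by adding $r-2$ new vertices to each edge of $F$, all new vertices distinct from each other and from $V(F)$; $K_{\ell+1}^r$ is the $r$-expansion of the complete graph $K_{\ell+1}$. $\mathcal{T}_r(n,\ell)$ is the complete balanced $\ell$-partite $r$-graph on $n$ vertices: the vertex set is partitioned into $\ell$ parts of sizes differing by at most one, and the hyperedges are all $r$-sets meeting each part in at most one vertex. $\mathcal{N}(\mathcal{G}_1,\mathcal{G}_2)$ is the number of copies of $\mathcal{G}_1$ in $\mathcal{G}_2$. $\mathrm{ex}_r(n,\mathcal{H},\mathcal{F})$ is the maximum number of copies of $\mathcal{H}$ in an $n$-vertex $r$-graph containing no copy of $\mathcal{F}$. *)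

theory Defs
  imports Main
begin

datatype 'a hypergraph = HG (verts: "'a set") (hedges: "'a set set")

definition rgraph :: "nat \<Rightarrow> 'a hypergraph \<Rightarrow> bool" where
  "rgraph r G \<longleftrightarrow> finite (verts G) \<and> (\<forall>e\<in>hedges G. e \<subseteq> verts G \<and> card e = r)"

definition subhypergraph :: "'a hypergraph \<Rightarrow> 'a hypergraph \<Rightarrow> bool" where
  "subhypergraph S G \<longleftrightarrow>
     verts S \<subseteq> verts G \<and> hedges S \<subseteq> hedges G \<and> (\<forall>e\<in>hedges S. e \<subseteq> verts S)"

definition hg_iso :: "'a hypergraph \<Rightarrow> 'b hypergraph \<Rightarrow> bool" where
  "hg_iso H G \<longleftrightarrow>
     (\<exists>f. bij_betw f (verts H) (verts G) \<and> (\<lambda>e. f ` e) ` hedges H = hedges G)"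

text \<open>A copy is a (not necessarily induced) subhypergraph isomorphic to the given hypergraph;
  copies are counted unlabelled, i.e. as subhypergraphs and not as embeddings.\<close>

definition copies :: "'a hypergraph \<Rightarrow> 'b hypergraph \<Rightarrow> 'b hypergraph set" where
  "copies H G = {S. subhypergraph S G \<and> hg_iso H S}"

definition num_copies :: "'a hypergraph \<Rightarrow> 'b hypergraph \<Rightarrow> nat" where
  "num_copies H G = card (copies H G)"

definition hg_free :: "'a hypergraph \<Rightarrow> 'b hypergraph \<Rightarrow> bool" where
  "hg_free F G \<longleftrightarrow> copies F G = {}"

text \<open>Taking vertices in the natural numbers loses nothing, since every finite hypergraph is
  isomorphic to one of this form.\<close>

definition ex_copies :: "nat \<Rightarrow> nat \<Rightarrow> 'a hypergraph \<Rightarrow> 'b hypergraph \<Rightarrow> nat" where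
  "ex_copies r n H F =
     Max {num_copies H G | G :: nat hypergraph. rgraph r G \<and> card (verts G) = n \<and> hg_free F G}"

definition complete_rgraph :: "nat \<Rightarrow> nat \<Rightarrow> nat hypergraph" where
  "complete_rgraph r s = HG {..<s} {e. e \<subseteq> {..<s} \<and> card e = r}"

text \<open>The new vertices of the expansion are the pairs of an edge \<open>e\<close> and an index below
  \<open>r - 2\<close>.\<close>

definition expansion :: "nat \<Rightarrow> 'a hypergraph \<Rightarrow> ('a + 'a set \<times> nat) hypergraph" where
  "expansion r F =
     HG (Inl ` verts F \<union> Inr ` (hedges F \<times> {..<r - 2}))
        ((\<lambda>e. Inl ` e \<union> Inr ` ({e} \<times> {..<r - 2})) ` hedges F)"

text \<open>The parts are the residue classes modulo \<open>l\<close>; see \<open>turan_parts_balanced\<close> below.\<close>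

definition turan_part :: "nat \<Rightarrow> nat \<Rightarrow> nat \<Rightarrow> nat set" where
  "turan_part n l i = {v. v < n \<and> v mod l = i}"

definition turan_rgraph :: "nat \<Rightarrow> nat \<Rightarrow> nat \<Rightarrow> nat hypergraph" where
  "turan_rgraph r n l =
     HG {..<n} {e. e \<subseteq> {..<n} \<and> card e = r \<and> (\<forall>i<l. card (e \<inter> turan_part n l i) \<le> 1)}"

lemma turan_parts_cover:
  assumes "l > 0"
  shows "(\<Union>i<l. turan_part n l i) = {..<n}"
  using assms by (auto simp: turan_part_def)

lemma turan_parts_disjoint: "i \<noteq> j \<Longrightarrow> turan_part n l i \<inter> turan_part n l j = {}"
  by (auto simp: turan_part_def)

lemma card_turan_part:
  assumes "i < l"
  shows "card (turan_part n l i) = n div l + (if i < n mod l then 1 else 0)"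
proof (induction n)
  case 0
  then show ?case by (simp add: turan_part_def)
next
  case (Suc n)
  have "turan_part (Suc n) l i =
      (if n mod l = i then insert n (turan_part n l i) else turan_part n l i)"
    by (auto simp: turan_part_def less_Suc_eq)
  moreover have "finite (turan_part n l i)" "n \<notin> turan_part n l i"
    by (auto simp: turan_part_def)
  ultimately have "card (turan_part (Suc n) l i) =
      card (turan_part n l i) + (if n mod l = i then 1 else 0)"
    by simp
  then show ?case
    using Suc assms by (auto simp: mod_Suc div_Suc split: if_splits)
qed

lemma turan_parts_balanced:
  assumes "i < l" "j < l"
  shows "card (turan_part n l i) \<le> card (turan_part n l j) + 1"
  using assms by (simp add: card_turan_part)

lemma rgraph_complete_rgraph: "rgraph r (complete_rgraph r s)"
  by (simp add: rgraph_def complete_rgraph_def)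

lemma rgraph_turan_rgraph: "rgraph r (turan_rgraph r n l)"
  by (simp add: rgraph_def turan_rgraph_def)

lemma rgraph_expansion:
  assumes "rgraph 2 F" "r \<ge> 2"
  shows "rgraph r (expansion r F)"
proof -
  have "finite (hedges F)"
    using assms(1) by (auto simp: rgraph_def intro: finite_subset[of _ "Pow (verts F)"])
  moreover have "card (Inl ` e \<union> Inr ` ({e} \<times> {..<r - 2})) = r" if "e \<in> hedges F" for e
  proof -
    have "card e = 2" "finite e"
      using that assms(1) by (auto simp: rgraph_def intro: finite_subset)
    then show ?thesis
      using assms(2) by (subst card_Un_disjoint) (auto simp: card_image card_cartesian_product)
  qed
  ultimately show ?thesis
    using assms(1) by (fastforce simp: rgraph_def expansion_def)
qed

lemma copies_subset:
  assumes "rgraph r G"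
  shows "copies H G \<subseteq> (\<lambda>(V, E). HG V E) ` (Pow (verts G) \<times> Pow (Pow (verts G)))"
proof
  fix S assume S: "S \<in> copies H G"
  then have "verts S \<subseteq> verts G" "hedges S \<subseteq> Pow (verts G)"
    by (auto simp: copies_def subhypergraph_def)
  then show "S \<in> (\<lambda>(V, E). HG V E) ` (Pow (verts G) \<times> Pow (Pow (verts G)))"
    by (intro image_eqI[of _ _ "(verts S, hedges S)"]) auto
qed

lemma finite_copies:
  assumes "rgraph r G"
  shows "finite (copies H G)"
  using assms by (intro finite_subset[OF copies_subset[OF assms]]) (simp add: rgraph_def)

lemma finite_ex_copies_values:
  "finite {num_copies H G | G :: nat hypergraph. rgraph r G \<and> card (verts G) = n \<and> hg_free F G}"
proof (rule finite_subset)
  show "{num_copies H G | G :: nat hypergraph. rgraph r G \<and> card (verts G) = n \<and> hg_free F G}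
      \<subseteq> {..2 ^ n * 2 ^ 2 ^ n}"
  proof safe
    fix G :: "nat hypergraph"
    assume G: "rgraph r G" and n: "n = card (verts G)"
    let ?A = "Pow (verts G) \<times> Pow (Pow (verts G))"
    have fin: "finite (verts G)" using G by (simp add: rgraph_def)
    have "num_copies H G \<le> card ((\<lambda>(V, E). HG V E) ` ?A)"
      unfolding num_copies_def using fin by (intro card_mono copies_subset[OF G]) simp
    also have "\<dots> \<le> card ?A"
      using fin by (intro card_image_le) simp
    finally show "num_copies H G \<le> 2 ^ card (verts G) * 2 ^ 2 ^ card (verts G)"
      using fin by (simp add: card_cartesian_product card_Pow)
  qed
qed simp

end

theory Submission
  imports Defs Complex_Main
begin

text \<open>Call a pair of vertices thick if its codegree exceeds a suitable constant times \<open>n ^ (r - 3)\<close>.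
  Thick pairs can be expanded greedily, so in a hypergraph without the expanded clique the graph of
  thick pairs has no clique on \<open>l + 1\<close> vertices, and only \<open>O(n ^ (s - 1))\<close> copies of the complete
  \<open>r\<close>-graph on \<open>s\<close> vertices contain a thin pair.

  Let \<open>x n\<close> be the excess of the extremal number over the Turan hypergraph. If an extremal
  hypergraph has a vertex in too few copies, deleting it shows \<open>x n < x (n - 1)\<close>. If it has none,
  Zykov's bound on the links makes almost all thick degrees nearly \<open>(1 - 1 / l) n\<close>, so the
  thick graph is almost Turan; two vertices in the same part then cannot lie in a common hyperedge,
  since that one hyperedge together with thick pairs would give an expanded clique. Hence the
  hypergraph is \<open>l\<close>-partite and \<open>x n = 0\<close>. As \<open>x\<close> cannot decrease forever, it vanishes for
  all large \<open>n\<close>.\<close>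

section \<open>Cliques in graphs without large cliques\<close>

text \<open>The deletion threshold
  \<open>((l - 1) choose (s - 1)) * ((n - 1) div l) ^ (s - 1)\<close> is a lower bound for the
  number of cliques that the Turan hypergraph gains with its \<open>n\<close>-th vertex. Deleting a
  vertex below it therefore loses excess strictly, while a minimum clique degree at this threshold
  still has the leading term of the Turan value, so Zykov's bound can be inverted into a bound on
  thick degrees. The initial excess is never estimated: it is a natural number, and its strict
  decrease is what turns approximate structure into an exact count.

  The obstacle is that the total number of cliques with a thin pair and the number of cliques
  through one vertex have the same order \<open>n ^ (s - 1)\<close>. Averaging makes the thin
  contribution small at all but boundedly many vertices, yet at an exceptional vertex it could
  account for the whole clique degree, and then nothing is known about the thick degree there. This
  forces two rounds, with the constants of the second fixed before those of the first.\<close>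

definition kcliques :: "('a \<Rightarrow> 'a \<Rightarrow> bool) \<Rightarrow> 'a set \<Rightarrow> nat \<Rightarrow> 'a set set" where
  "kcliques D X k = {S. S \<subseteq> X \<and> card S = k \<and> pairwise D S}"

lemma finite_kcliques: "finite X \<Longrightarrow> finite (kcliques D X k)"
  by (rule finite_subset[of _ "Pow X"]) (auto simp: kcliques_def)

lemma kcliques_0: "finite X \<Longrightarrow> kcliques D X 0 = {{}}"
  by (auto simp: kcliques_def dest: finite_subset)

lemma kcliques_empty: "k > 0 \<Longrightarrow> kcliques D {} k = {}"
  by (auto simp: kcliques_def)

lemma card_kcliques_containing:
  assumes fin: "finite X" and v: "v \<in> X" and sym: "\<And>x y. D x y \<Longrightarrow> D y x" and irr: "\<And>x. \<not> D x x"
  shows "card {S \<in> kcliques D X (Suc k). v \<in> S} = card (kcliques D {w \<in> X. D v w} k)"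
proof (rule bij_betw_same_card[of "\<lambda>S. S - {v}"], rule bij_betw_byWitness[where f' = "insert v"])
  show "\<forall>a\<in>{S \<in> kcliques D X (Suc k). v \<in> S}. insert v (a - {v}) = a" by auto
  show "\<forall>a'\<in>kcliques D {w \<in> X. D v w} k. insert v a' - {v} = a'"
    using irr by (auto simp: kcliques_def)
  show "(\<lambda>S. S - {v}) ` {S \<in> kcliques D X (Suc k). v \<in> S} \<subseteq> kcliques D {w \<in> X. D v w} k"
    by (auto simp: kcliques_def pairwise_def)
  show "insert v ` kcliques D {w \<in> X. D v w} k \<subseteq> {S \<in> kcliques D X (Suc k). v \<in> S}"
  proof safe
    fix S assume S: "S \<in> kcliques D {w \<in> X. D v w} k"
    then have "finite S" "v \<notin> S" using fin irr by (auto simp: kcliques_def dest: finite_subset)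
    then show "insert v S \<in> kcliques D X (Suc k)"
      using S v sym by (auto simp: kcliques_def pairwise_insert)
  qed
qed

text \<open>The left side is the tangent of \<open>y ^ Suc k\<close> at the point \<open>x\<close>,
  and a convex curve lies above its tangents. It closes the induction in
  \<open>card_kcliques_le\<close>.\<close>

lemma bernoulli_two_variables:
  fixes x y :: real
  assumes "x \<ge> 0" "y \<ge> 0"
  shows "real (Suc k) * y * x ^ k - real k * x ^ Suc k \<le> y ^ Suc k"
proof (induction k)
  case (Suc k)
  have "0 \<le> real (Suc k) * x ^ k * (y - x)\<^sup>2"
    using assms by simp
  also have "\<dots> = y * (real (Suc k) * y * x ^ k - real k * x ^ Suc k)
      - (real (Suc (Suc k)) * y * x ^ Suc k - real (Suc k) * x ^ Suc (Suc k))"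
    by (simp add: algebra_simps power2_eq_square)
  also have "\<dots> \<le> y * y ^ Suc k
      - (real (Suc (Suc k)) * y * x ^ Suc k - real (Suc k) * x ^ Suc (Suc k))"
    using mult_left_mono[OF Suc.IH assms(2)] by simp
  finally show ?case by simp
qed simp

text \<open>Zykov's theorem, by induction on \<open>l\<close>: the neighbourhood \<open>N\<close> of
  a vertex in the most \<open>k\<close>-cliques has no clique on one vertex fewer, and each vertex
  outside \<open>N\<close> lies in no more \<open>k\<close>-cliques than that vertex does.\<close>

lemma card_kcliques_le:
  assumes sym: "\<And>x y. D x y \<Longrightarrow> D y x" and irr: "\<And>x. \<not> D x x"
  assumes "finite X" "kcliques D X (Suc l) = {}"
  shows "real (card (kcliques D X k)) \<le> real (l choose k) * (real (card X) / real l) ^ k"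
  using assms(3,4)
proof (induction l arbitrary: X k)
  case 0
  have "X = {}"
  proof (rule ccontr)
    assume "X \<noteq> {}"
    then obtain x where "x \<in> X" by auto
    then have "{x} \<in> kcliques D X (Suc 0)" by (auto simp: kcliques_def)
    then show False using 0 by auto
  qed
  then show ?case
    by (cases k) (auto simp: kcliques_0 kcliques_empty)
next
  case (Suc l)
  note fin = Suc.prems(1)
  show ?case
  proof (cases k)
    case 0
    then show ?thesis using fin by (simp add: kcliques_0)
  next
    case (Suc j)
    show ?thesis
    proof (cases "X = {}")
      case True
      then show ?thesis using Suc by (simp add: kcliques_empty)
    next
      case False
      define g where "g v = card {S \<in> kcliques D X (Suc j). v \<in> S}" for v
      have "finite (g ` X)" "g ` X \<noteq> {}" using fin False by auto
      then obtain v where v: "v \<in> X" and gv: "\<And>u. u \<in> X \<Longrightarrow> g u \<le> g v"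
        using Max_in[of "g ` X"] Max_ge[of "g ` X"] by (metis (no_types, lifting) imageE imageI)
      define N where "N = {w \<in> X. D v w}"
      have finN: "finite N" and NX: "N \<subseteq> X" using fin by (auto simp: N_def)
      have gN: "g v = card (kcliques D N j)"
        unfolding g_def N_def by (rule card_kcliques_containing[OF fin v sym irr])
      have "kcliques D N (Suc l) = {}"
      proof -
        have "card (kcliques D N (Suc l)) = card {S \<in> kcliques D X (Suc (Suc l)). v \<in> S}"
          unfolding N_def by (rule card_kcliques_containing[OF fin v sym irr, symmetric])
        also have "\<dots> = 0" using Suc.prems(2) by simp
        finally show ?thesis using finite_kcliques[OF finN] by simp
      qed
      note IH = Suc.IH[OF finN this]
      \<comment> \<open>A clique that is not inside \<open>N\<close> contains a vertex of
        \<open>X - N\<close>. The vertex \<open>v\<close> itself belongs to \<open>X - N\<close>, so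
        its own cliques are covered as well.\<close>
      have "kcliques D X k \<subseteq> kcliques D N k \<union> (\<Union>u\<in>X - N. {S \<in> kcliques D X (Suc j). u \<in> S})"
        unfolding \<open>k = Suc j\<close> by (auto simp: kcliques_def)
      then have "card (kcliques D X k)
          \<le> card (kcliques D N k \<union> (\<Union>u\<in>X - N. {S \<in> kcliques D X (Suc j). u \<in> S}))"
        using fin finN by (intro card_mono) (auto simp: finite_kcliques)
      also have "\<dots> \<le> card (kcliques D N k) + (\<Sum>u\<in>X - N. g u)"
        unfolding g_def using fin
        by (intro order_trans[OF card_Un_le] add_left_mono card_UN_le) auto
      also have "\<dots> \<le> card (kcliques D N k) + (\<Sum>u\<in>X - N. g v)"
        using gv by (intro add_left_mono sum_mono) auto
      also have "\<dots> = card (kcliques D N k) + (card X - card N) * card (kcliques D N j)"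
        using finN NX by (simp add: gN card_Diff_subset)
      finally have 1: "real (card (kcliques D X k)) \<le> real (card (kcliques D N k))
          + (real (card X) - real (card N)) * real (card (kcliques D N j))"
        using card_mono[OF fin NX] by (simp flip: of_nat_diff of_nat_mult of_nat_add)
      define x where "x = real (card N) / real l"
      define y where "y = real (card X) / real (Suc l)"
      have x0: "x \<ge> 0" "y \<ge> 0" by (auto simp: x_def y_def)
      \<comment> \<open>For \<open>l = 0\<close> the division by zero gives \<open>x = 0\<close>;
        the equation survives because \<open>N\<close> is then empty.\<close>
      have cN: "real (card N) = real l * x"
      proof (cases "l = 0")
        case True
        then have "kcliques D N (Suc 0) = {}" using \<open>kcliques D N (Suc l) = {}\<close> by simp
        then have "N = {}"
          by (auto simp: kcliques_def dest: spec[of _ "{_}"])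
        then show ?thesis using True by simp
      qed (simp add: x_def)
      have cX: "real (card X) = real (Suc l) * y" by (simp add: y_def)
      have b1: "real (Suc l) * real (l choose k) = (real (Suc l) - real k) * real (Suc l choose k)"
      proof (cases "k \<le> Suc l")
        case True
        then show ?thesis
          using binomial_absorb_comp[of "Suc l" k]
          by (metis diff_Suc_1 of_nat_diff of_nat_mult)
      qed (simp add: binomial_eq_0)
      have b2: "real (Suc l) * real (l choose j) = real k * real (Suc l choose k)"
        unfolding \<open>k = Suc j\<close> using Suc_times_binomial_eq[of l j]
        by (metis mult.commute of_nat_mult)
      have "real (Suc l) * real (card (kcliques D X k)) \<le>
          real (Suc l) * (real (l choose k) * x ^ k + (real (card X) - real (card N)) * (real (l choose j) * x ^ j))"
        using 1 IH[of k] IH[of j] card_mono[OF fin NX] unfolding x_def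
        by (intro mult_left_mono order_trans[OF 1] add_mono mult_left_mono) auto
      also have "\<dots> = (real (Suc l) * real (l choose k)) * x ^ k
          + (real (card X) - real (card N)) * (real (Suc l) * real (l choose j)) * x ^ j"
        by (simp add: algebra_simps)
      \<comment> \<open>The size of \<open>N\<close> is unknown, so \<open>x\<close> is a free
        variable here. The bracket is the tangent expression, hence at most \<open>y ^ k\<close>,
        with equality for the balanced value \<open>x = y\<close>.\<close>
      also have "\<dots> = real (Suc l) * (real (Suc l choose k) * (real k * y * x ^ j - real j * x ^ k))"
        unfolding b1 b2 cN cX unfolding \<open>k = Suc j\<close> by (simp add: algebra_simps del: binomial_Suc_Suc)
      also have "\<dots> \<le> real (Suc l) * (real (Suc l choose k) * y ^ k)"
        using bernoulli_two_variables[OF x0, of j] unfolding \<open>k = Suc j\<close>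
        by (intro mult_left_mono) auto
      finally show ?thesis
        unfolding y_def by (simp del: of_nat_Suc)
    qed
  qed
qed

section \<open>Greedy choice and the structure of nearly extremal graphs\<close>

text \<open>When an index is added, at most \<open>b\<close> representatives are already chosen and
  each excludes at most \<open>t\<close> candidates, so \<open>X k\<close> is not exhausted. The
  sets may overlap: \<open>near_turan_partition\<close> first takes all of them equal to
  \<open>U\<close>, merely to find a clique.\<close>

lemma greedy_transversal:
  fixes t :: real
  assumes sym: "\<And>x y. D x y \<Longrightarrow> D y x"
  assumes "finite I" "card I \<le> Suc b" "t \<ge> 0"
  assumes "\<And>i. i \<in> I \<Longrightarrow> finite (X i) \<and> real (card (X i)) > real b * t"
  assumes "\<And>i j x. i \<in> I \<Longrightarrow> j \<in> I \<Longrightarrow> i \<noteq> j \<Longrightarrow> x \<in> X i \<Longrightarrow> real (card {y \<in> X j. \<not> D x y}) \<le> t"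
  shows "\<exists>w. (\<forall>i\<in>I. w i \<in> X i) \<and> (\<forall>i\<in>I. \<forall>j\<in>I. i \<noteq> j \<longrightarrow> D (w i) (w j))"
  using assms(2-)
proof (induction I rule: finite_induct)
  case (insert k I)
  have "\<exists>w. (\<forall>i\<in>I. w i \<in> X i) \<and> (\<forall>i\<in>I. \<forall>j\<in>I. i \<noteq> j \<longrightarrow> D (w i) (w j))"
    using insert.prems insert.hyps by (intro insert.IH) auto
  then obtain w where w: "\<And>i. i \<in> I \<Longrightarrow> w i \<in> X i"
      "\<And>i j. i \<in> I \<Longrightarrow> j \<in> I \<Longrightarrow> i \<noteq> j \<Longrightarrow> D (w i) (w j)" by blast
  let ?M = "\<Union>i\<in>I. {y \<in> X k. \<not> D (w i) y}"
  have finM: "finite ?M" using insert by auto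
  have "real (card ?M) \<le> real (\<Sum>i\<in>I. card {y \<in> X k. \<not> D (w i) y})"
    using card_UN_le[OF insert.hyps(1), of "\<lambda>i. {y \<in> X k. \<not> D (w i) y}"] by (simp only: of_nat_le_iff)
  also have "\<dots> \<le> (\<Sum>i\<in>I. t)"
    unfolding of_nat_sum
  proof (intro sum_mono)
    fix i assume "i \<in> I"
    then show "real (card {y \<in> X k. \<not> D (w i) y}) \<le> t"
      using insert.prems(4)[of i k "w i"] w insert.hyps by auto
  qed
  also have "\<dots> \<le> real b * t"
    using insert.prems insert.hyps by (auto intro: mult_right_mono)
  also have "\<dots> < card (X k)" using insert.prems(3)[of k] by simp
  finally have "card ?M < card (X k)" by simp
  then obtain z where z: "z \<in> X k" "z \<notin> ?M"
    using card_mono[OF finM, of "X k"] by (meson linorder_not_less subsetI)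
  have zD: "D (w i) z" "D z (w i)" if "i \<in> I" for i
    using z that sym[of "w i" z] by auto
  show ?case
  proof (intro exI conjI ballI impI)
    fix i assume "i \<in> insert k I"
    then show "(w(k := z)) i \<in> X i" using z w insert.hyps by auto
  next
    fix i j assume "i \<in> insert k I" "j \<in> insert k I" "i \<noteq> j"
    then show "D ((w(k := z)) i) ((w(k := z)) j)" using zD w insert.hyps by auto
  qed
qed auto

text \<open>The parts come from an \<open>l\<close>-clique \<open>v\<close>: part \<open>i\<close> collects the common neighbours of the
  \<open>v j\<close> with \<open>j \<noteq> i\<close>. These sets are independent and nearly exhaust \<open>U\<close>, and every other vertex
  has few neighbours in one of them.\<close>

lemma near_turan_partition:
  fixes \<epsilon> :: real
  assumes sym: "\<And>x y. D x y \<Longrightarrow> D y x" and irr: "\<And>x. \<not> D x x"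
  assumes fin: "finite U" and ne: "U \<noteq> {}" and free: "kcliques D U (Suc l) = {}" and l: "l \<ge> 1"
  assumes deg: "\<And>u. u \<in> U \<Longrightarrow> real (card {w \<in> U. D u w}) \<ge> (1 - 1 / l - \<epsilon>) * card U"
  assumes \<epsilon>: "\<epsilon> > 0" "\<epsilon> * (4 * real l ^ 3) \<le> 1"
  shows "\<exists>f. f ` U \<subseteq> {..<l}
    \<and> (\<forall>u\<in>U. real (card {w \<in> U. f w \<noteq> f u \<and> \<not> D u w}) \<le> real l ^ 2 * \<epsilon> * card U)
    \<and> (\<forall>i<l. real (card {u \<in> U. f u = i}) \<ge> (1 / l - l * \<epsilon>) * card U)"
proof -
  define N where "N = real (card U)"
  \<comment> \<open>An upper bound for the number of non-neighbours of a vertex, the vertex itself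
    included.\<close>
  define \<mu> where "\<mu> = (1 / l + \<epsilon>) * N"
  have N0: "N > 0" using fin ne by (auto simp: N_def card_gt_0_iff)
  have \<mu>0: "\<mu> \<ge> 0" using N0 \<epsilon> by (auto simp: \<mu>_def)
  have l0: "real l \<ge> 1" using l by simp
  have miss: "real (card {w \<in> U. \<not> D u w}) \<le> \<mu>" if "u \<in> U" for u
  proof -
    have "card U = card ({w \<in> U. D u w} \<union> {w \<in> U. \<not> D u w})" by (rule arg_cong[of _ _ card]) auto
    also have "\<dots> = card {w \<in> U. D u w} + card {w \<in> U. \<not> D u w}"
      using fin by (intro card_Un_disjoint) auto
    finally show ?thesis using deg[OF that] by (simp add: \<mu>_def N_def algebra_simps)
  qed
  have e2: "real l ^ 2 * \<epsilon> * 4 \<le> 1 / l"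
    using \<epsilon> l0 by (simp add: field_simps power2_eq_square power3_eq_cube)
  have lsq: "real l \<le> real l ^ 2" using l0 by (simp add: power2_eq_square)
  then have ele: "l * \<epsilon> \<le> real l ^ 2 * \<epsilon>" using \<epsilon> by simp
  have el: "l * \<epsilon> * 4 \<le> 1 / l" using e2 ele by linarith
  have "1 / real l > 0" using l0 by simp
  have llm: "real (l - 1) * \<mu> = N * (1 - 1 / l + (l - 1) * \<epsilon>)"
    using l by (simp add: \<mu>_def field_simps of_nat_diff)
  have lm: "real (l - 1) * \<mu> \<le> N * (1 - 1 / l + l * \<epsilon> - \<epsilon>)"
    unfolding llm using l by (simp add: of_nat_diff algebra_simps)
  have "1 - 1 / l + l * \<epsilon> - \<epsilon> < 1" using el \<epsilon> \<open>1 / real l > 0\<close> by linarith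
  then have lmN: "real (l - 1) * \<mu> < N" using lm N0 by (smt (verit) mult_le_cancel_left1)
  have cliqueI: False if "finite K" "K \<subseteq> U" "card K = Suc l" "pairwise D K" for K
    using free that by (auto simp: kcliques_def)
  have "\<exists>v. (\<forall>i\<in>{..<l}. v i \<in> U) \<and> (\<forall>i\<in>{..<l}. \<forall>j\<in>{..<l}. i \<noteq> j \<longrightarrow> D (v i) (v j))"
    using l \<mu>0 fin lmN miss
    by (intro greedy_transversal[of D _ "l - 1" \<mu>, OF sym]) (auto simp: N_def)
  then obtain v where v: "\<And>i. i < l \<Longrightarrow> v i \<in> U"
    and vD: "\<And>i j. i < l \<Longrightarrow> j < l \<Longrightarrow> i \<noteq> j \<Longrightarrow> D (v i) (v j)"
    by (metis lessThan_iff)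
  have vD': "D (v i) (v j)" if "i < l" "j < l" "v i \<noteq> v j" for i j
    using vD that by metis
  have vinj: "inj_on v {..<l}"
    using vD irr by (intro inj_onI) (metis lessThan_iff)
  define V where "V i = {u \<in> U. \<forall>j<l. j \<noteq> i \<longrightarrow> D u (v j)}" for i
  have finV: "finite (V i)" and VU: "V i \<subseteq> U" for i using fin by (auto simp: V_def)
  \<comment> \<open>Each of the other \<open>l - 1\<close> clique vertices excludes at most
    \<open>\<mu>\<close>. The surplus \<open>\<epsilon> * N\<close> is kept because it cancels the
    \<open>\<epsilon>\<close> of \<open>\<mu>\<close> in \<open>missV\<close>.\<close>
  have Vcard: "real (card (V i)) \<ge> (1 / l - l * \<epsilon>) * N + \<epsilon> * N" if i: "i < l" for i
  proof -
    let ?M = "\<Union>j\<in>{..<l} - {i}. {u \<in> U. \<not> D (v j) u}"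
    have "U \<subseteq> V i \<union> ?M" using sym by (auto simp: V_def)
    then have "card U \<le> card (V i \<union> ?M)" using fin finV by (intro card_mono) auto
    also have "\<dots> \<le> card (V i) + (\<Sum>j\<in>{..<l} - {i}. card {u \<in> U. \<not> D (v j) u})"
      by (intro order_trans[OF card_Un_le] add_left_mono card_UN_le) auto
    finally have "N \<le> real (card (V i)) + (\<Sum>j\<in>{..<l} - {i}. real (card {u \<in> U. \<not> D (v j) u}))"
      unfolding N_def by (simp flip: of_nat_sum of_nat_add)
    also have "(\<Sum>j\<in>{..<l} - {i}. real (card {u \<in> U. \<not> D (v j) u})) \<le> (\<Sum>j\<in>{..<l} - {i}. \<mu>)"
      using v miss by (intro sum_mono) auto
    also have "\<dots> = real (l - 1) * \<mu>" using i by simp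
    finally show ?thesis using lm by (simp add: algebra_simps)
  qed
  have Vdisj: False if "i < l" "u \<in> V i" "\<And>j. j < l \<Longrightarrow> D u (v j)" for u i
  proof (rule cliqueI[of "insert u (v ` {..<l})"])
    have "u \<notin> v ` {..<l}" using that irr by auto
    then show "card (insert u (v ` {..<l})) = Suc l" by (simp add: card_image vinj)
    show "pairwise D (insert u (v ` {..<l}))"
      using that sym vD' by (auto simp: pairwise_def)
  qed (use that v VU in auto)
  have Vindep: "\<not> D x y" if i: "i < l" and xy: "x \<in> V i" "y \<in> V i" for i x y
  proof
    assume D: "D x y"
    show False
    proof (rule cliqueI[of "insert x (insert y (v ` ({..<l} - {i})))"])
      have "x \<notin> v ` ({..<l} - {i})" "y \<notin> v ` ({..<l} - {i})" "x \<noteq> y"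
        using xy D irr by (auto simp: V_def)
      moreover have "card (v ` ({..<l} - {i})) = l - 1"
        using i vinj by (subst card_image) (auto intro: inj_on_subset)
      ultimately show "card (insert x (insert y (v ` ({..<l} - {i})))) = Suc l"
        using l by simp
      show "pairwise D (insert x (insert y (v ` ({..<l} - {i}))))"
        using xy sym vD' D by (auto simp: pairwise_def V_def)
    qed (use v VU xy in auto)
  qed
  \<comment> \<open>A vertex has a budget of about \<open>N / l\<close> non-neighbours. If it sees
    little of \<open>V i\<close>, that set uses up nearly the whole budget, and little is left for
    the rest of \<open>U\<close>.\<close>
  have missV: "real (card ({w \<in> U. \<not> D u w} - V i)) \<le> l * \<epsilon> * N + t"
    if "u \<in> U" "i < l" and t: "real (card {w \<in> V i. D u w}) \<le> t" for u i t
  proof -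
    have "card (V i) = card ({w \<in> V i. D u w} \<union> {w \<in> V i. \<not> D u w})" by (rule arg_cong[of _ _ card]) auto
    also have "\<dots> = card {w \<in> V i. D u w} + card {w \<in> V i. \<not> D u w}"
      using finV by (intro card_Un_disjoint) auto
    finally have 1: "real (card {w \<in> V i. \<not> D u w}) \<ge> real (card (V i)) - t" using t by simp
    have "card {w \<in> U. \<not> D u w} = card (({w \<in> U. \<not> D u w} - V i) \<union> {w \<in> V i. \<not> D u w})"
      using VU by (intro arg_cong[of _ _ card]) auto
    also have "\<dots> = card ({w \<in> U. \<not> D u w} - V i) + card {w \<in> V i. \<not> D u w}"
      using fin finV by (intro card_Un_disjoint) auto
    finally show ?thesis
      using 1 miss[OF that(1)] Vcard[OF that(2)] by (simp add: \<mu>_def algebra_simps)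
  qed
  have missVV: "real (card {w \<in> V j. \<not> D u w}) \<le> l * \<epsilon> * N" if "i < l" "j < l" "i \<noteq> j" "u \<in> V i" for i j u
  proof -
    have "V i \<inter> V j = {}"
    proof (rule ccontr)
      assume "V i \<inter> V j \<noteq> {}"
      then obtain x where x: "x \<in> V i" "x \<in> V j" by auto
      then have "D x (v k)" if "k < l" for k
        using \<open>i \<noteq> j\<close> that by (cases "k = i") (auto simp: V_def)
      then show False using Vdisj[OF \<open>i < l\<close> x(1)] by auto
    qed
    then have "card {w \<in> V j. \<not> D u w} \<le> card ({w \<in> U. \<not> D u w} - V i)"
      using fin VU by (intro card_mono) auto
    moreover have "{w \<in> V i. D u w} = {}" using Vindep that by auto
    then have "real (card {w \<in> V i. D u w}) \<le> 0" by (simp only: card.empty of_nat_0 order_refl)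
    then have "real (card ({w \<in> U. \<not> D u w} - V i)) \<le> l * \<epsilon> * N + 0"
      using that VU by (intro missV) auto
    ultimately show ?thesis by linarith
  qed
  \<comment> \<open>Otherwise \<open>u\<close> has many neighbours in every \<open>V i\<close>; as
    these sets are almost completely joined, a greedy choice among the neighbours gives an
    \<open>l\<close>-clique, which \<open>u\<close> extends.\<close>
  have ex: "\<exists>i<l. real (card {w \<in> V i. D u w}) \<le> real (l - 1) * (l * \<epsilon> * N)" if u: "u \<in> U" for u
  proof (rule ccontr)
    assume A: "\<not> ?thesis"
    have "\<exists>w. (\<forall>i\<in>{..<l}. w i \<in> {w \<in> V i. D u w}) \<and> (\<forall>i\<in>{..<l}. \<forall>j\<in>{..<l}. i \<noteq> j \<longrightarrow> D (w i) (w j))"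
    proof (rule greedy_transversal[of D _ "l - 1" "l * \<epsilon> * N", OF sym])
      show "0 \<le> l * \<epsilon> * N" using \<epsilon> N0 by simp
      fix i assume "i \<in> {..<l}"
      then show "finite {w \<in> V i. D u w} \<and> real (l - 1) * (l * \<epsilon> * N) < real (card {w \<in> V i. D u w})"
        using A finV by auto
    next
      fix i j x assume ij: "i \<in> {..<l}" "j \<in> {..<l}" "i \<noteq> j" "x \<in> {w \<in> V i. D u w}"
      have "card {y \<in> {w \<in> V j. D u w}. \<not> D x y} \<le> card {w \<in> V j. \<not> D x w}"
        using finV by (intro card_mono) auto
      then show "real (card {y \<in> {w \<in> V j. D u w}. \<not> D x y}) \<le> l * \<epsilon> * N"
        using missVV[of i j x] ij by simp
    qed (use l in auto)
    then obtain w where w: "\<And>i. i < l \<Longrightarrow> w i \<in> V i \<and> D u (w i)"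
      "\<And>i j. i < l \<Longrightarrow> j < l \<Longrightarrow> i \<noteq> j \<Longrightarrow> D (w i) (w j)" by auto
    have wU: "w i \<in> U" if "i < l" for i using w(1)[OF that] VU by blast
    have wD: "D (w i) (w j)" if "i < l" "j < l" "w i \<noteq> w j" for i j
      using w(2) that by metis
    have winj: "inj_on w {..<l}" using w irr by (intro inj_onI) (metis lessThan_iff)
    show False
    proof (rule cliqueI[of "insert u (w ` {..<l})"])
      have "u \<notin> w ` {..<l}" using w irr by auto
      then show "card (insert u (w ` {..<l})) = Suc l" by (simp add: card_image winj)
      show "pairwise D (insert u (w ` {..<l}))" using w(1) wD sym by (auto simp: pairwise_def)
    qed (use wU u in auto)
  qed
  then obtain f where f: "\<And>u. u \<in> U \<Longrightarrow> f u < l"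
    and fd: "\<And>u. u \<in> U \<Longrightarrow> real (card {w \<in> V (f u). D u w}) \<le> real (l - 1) * (l * \<epsilon> * N)"
    by metis
  have l1: "real (l - 1) * (l * \<epsilon> * N) + l * \<epsilon> * N = real l ^ 2 * \<epsilon> * N"
    using l by (simp add: of_nat_diff algebra_simps power2_eq_square)
  \<comment> \<open>The choice of \<open>f\<close> was free, but on \<open>V i\<close> it must
    return \<open>i\<close>: a vertex of \<open>V i\<close> misses few vertices of another
    \<open>V j\<close>, so having few neighbours there as well would make \<open>V j\<close> too
    small.\<close>
  have fV: "f u = i" if "i < l" "u \<in> V i" for u i
  proof (rule ccontr)
    assume ne: "f u \<noteq> i"
    have uU: "u \<in> U" using that VU by auto
    have "card (V (f u)) = card ({w \<in> V (f u). D u w} \<union> {w \<in> V (f u). \<not> D u w})" by (rule arg_cong[of _ _ card]) auto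
    also have "\<dots> = card {w \<in> V (f u). D u w} + card {w \<in> V (f u). \<not> D u w}"
      using finV by (intro card_Un_disjoint) auto
    finally have "real (card (V (f u))) \<le> real l ^ 2 * \<epsilon> * N"
      using fd[OF uU] missVV[of i "f u" u] f[OF uU] that ne l1 by simp
    moreover have "real (card (V (f u))) \<ge> (1 / l - l * \<epsilon>) * N + \<epsilon> * N"
      using Vcard f uU by simp
    ultimately have "(1 / l - l * \<epsilon> + \<epsilon>) * N \<le> (real l ^ 2 * \<epsilon>) * N" by (simp add: algebra_simps)
    then have "1 / l - l * \<epsilon> + \<epsilon> \<le> real l ^ 2 * \<epsilon>" using N0 by simp
    then show False using e2 el \<epsilon> \<open>1 / real l > 0\<close> by linarith
  qed
  show ?thesis
  proof (intro exI conjI ballI allI impI)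
    show "f ` U \<subseteq> {..<l}" using f by auto
  next
    fix u assume u: "u \<in> U"
    have "card {w \<in> U. f w \<noteq> f u \<and> \<not> D u w} \<le> card ({w \<in> U. \<not> D u w} - V (f u))"
      using fin f[OF u] fV by (intro card_mono) auto
    also have "real \<dots> \<le> l * \<epsilon> * N + real (l - 1) * (l * \<epsilon> * N)"
      using missV[OF u f[OF u] fd[OF u]] .
    also have "\<dots> = real l ^ 2 * \<epsilon> * N" using l1 by linarith
    finally show "real (card {w \<in> U. f w \<noteq> f u \<and> \<not> D u w}) \<le> real l ^ 2 * \<epsilon> * card U"
      by (simp add: N_def)
  next
    fix i assume i: "i < l"
    have "card (V i) \<le> card {u \<in> U. f u = i}" using fin fV[OF i] VU by (intro card_mono) auto
    moreover have "\<epsilon> * N \<ge> 0" using \<epsilon> N0 by simp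
    ultimately show "real (card {u \<in> U. f u = i}) \<ge> (1 / l - l * \<epsilon>) * card U"
      using Vcard[OF i] by (simp add: N_def)
  qed
qed

section \<open>Transversals and elementary symmetric functions\<close>

text \<open>The elementary symmetric polynomial of degree \<open>k\<close>. At part sizes it counts
  the \<open>k\<close>-sets with at most one vertex in each part, as
  \<open>card_transversals\<close> shows.\<close>

definition esym :: "'i set \<Rightarrow> ('i \<Rightarrow> nat) \<Rightarrow> nat \<Rightarrow> nat" where
  "esym I a k = (\<Sum>J | J \<subseteq> I \<and> card J = k. \<Prod>j\<in>J. a j)"

lemma esym_0: "finite I \<Longrightarrow> esym I a 0 = 1"
proof -
  assume "finite I"
  then have "{J. J \<subseteq> I \<and> card J = 0} = {{}}" by (auto dest: finite_subset)
  then show ?thesis by (simp add: esym_def)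
qed

lemma esym_empty: "esym {} a (Suc k) = 0"
proof -
  have "{J. J \<subseteq> ({} :: 'a set) \<and> card J = Suc k} = {}" by auto
  then show ?thesis unfolding esym_def by (simp only: sum.empty)
qed

lemma esym_cong: "(\<And>i. i \<in> I \<Longrightarrow> a i = b i) \<Longrightarrow> esym I a k = esym I b k"
  unfolding esym_def by (intro sum.cong prod.cong) auto

lemma esym_insert:
  assumes "finite I" "i \<notin> I"
  shows "esym (insert i I) a (Suc k) = esym I a (Suc k) + a i * esym I a k"
proof -
  have eq: "{J. J \<subseteq> insert i I \<and> card J = Suc k}
      = {J. J \<subseteq> I \<and> card J = Suc k} \<union> insert i ` {J. J \<subseteq> I \<and> card J = k}"
  proof (intro equalityI subsetI)
    fix J assume J: "J \<in> {J. J \<subseteq> insert i I \<and> card J = Suc k}"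
    show "J \<in> {J. J \<subseteq> I \<and> card J = Suc k} \<union> insert i ` {J. J \<subseteq> I \<and> card J = k}"
    proof (cases "i \<in> J")
      case True
      then have "J = insert i (J - {i})" "J - {i} \<subseteq> I" "card (J - {i}) = k" using J by auto
      then show ?thesis by blast
    qed (use J in auto)
  next
    fix J assume "J \<in> {J. J \<subseteq> I \<and> card J = Suc k} \<union> insert i ` {J. J \<subseteq> I \<and> card J = k}"
    then show "J \<in> {J. J \<subseteq> insert i I \<and> card J = Suc k}"
    proof
      assume "J \<in> insert i ` {J. J \<subseteq> I \<and> card J = k}"
      then obtain J' where J': "J = insert i J'" "J' \<subseteq> I" "card J' = k" by auto
      then have "finite J'" "i \<notin> J'" using assms by (auto dest: finite_subset)
      then show ?thesis using J' by auto
    qed auto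
  qed
  have "esym (insert i I) a (Suc k) = esym I a (Suc k)
      + (\<Sum>J\<in>insert i ` {J. J \<subseteq> I \<and> card J = k}. \<Prod>j\<in>J. a j)"
    unfolding esym_def eq using assms by (intro sum.union_disjoint) auto
  also have "(\<Sum>J\<in>insert i ` {J. J \<subseteq> I \<and> card J = k}. \<Prod>j\<in>J. a j)
      = (\<Sum>J | J \<subseteq> I \<and> card J = k. \<Prod>j\<in>insert i J. a j)"
    using assms(2) by (subst sum.reindex) (auto simp: inj_on_def)
  also have "\<dots> = (\<Sum>J | J \<subseteq> I \<and> card J = k. a i * (\<Prod>j\<in>J. a j))"
  proof (intro sum.cong refl)
    fix J assume "J \<in> {J. J \<subseteq> I \<and> card J = k}"
    then have "finite J" "i \<notin> J" using assms by (auto dest: finite_subset)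
    then show "(\<Prod>j\<in>insert i J. a j) = a i * (\<Prod>j\<in>J. a j)" by simp
  qed
  finally show ?thesis by (simp add: esym_def sum_distrib_left)
qed

lemma esym_ge_power:
  assumes "finite I" "\<And>i. i \<in> I \<Longrightarrow> q \<le> a i"
  shows "(card I choose k) * q ^ k \<le> esym I a k"
proof -
  have "(card I choose k) * q ^ k = (\<Sum>J | J \<subseteq> I \<and> card J = k. \<Prod>j\<in>J. q)"
    using n_subsets[OF assms(1), of k] by simp
  also have "\<dots> \<le> esym I a k"
    unfolding esym_def using assms by (intro sum_mono prod_mono) auto
  finally show ?thesis .
qed

text \<open>As a polynomial in \<open>a i\<close> and \<open>a j\<close> the value is
  \<open>A + B * (a i + a j) + C * (a i * a j)\<close> with nonnegative \<open>A\<close>,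
  \<open>B\<close>, \<open>C\<close> depending on the other entries only. The move keeps the sum and
  does not decrease the product.\<close>

lemma esym_move_unit:
  assumes "finite I" "i \<in> I" "j \<in> I" "i \<noteq> j" "a i > a j"
  shows "esym I a k \<le> esym I (a(i := a i - 1, j := a j + 1)) k"
proof -
  define R where "R = I - {i, j}"
  define b where "b = a(i := a i - 1, j := a j + 1)"
  have I: "I = insert i (insert j R)" and R: "finite R" "i \<notin> insert j R" "j \<notin> R"
    using assms by (auto simp: R_def)
  have cong: "esym R b m = esym R a m" for m
    by (rule esym_cong) (auto simp: b_def R_def)
  have b: "b i = a i - 1" "b j = a j + 1" using assms by (auto simp: b_def)
  have "esym I a k \<le> esym I b k"
  proof (cases k)
    case 0
    then show ?thesis using assms by (simp add: esym_0)
  next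
    case (Suc m)
    obtain c where c: "a i = Suc (a j + c)" using assms(5) less_imp_Suc_add by auto
    show ?thesis
    proof (cases m)
      case 0
      then show ?thesis unfolding Suc I using R
        by (simp add: esym_insert esym_0 cong b c)
    next
      case (Suc p)
      then show ?thesis unfolding \<open>k = Suc m\<close> I using R
        by (simp add: esym_insert cong b c algebra_simps)
    qed
  qed
  then show ?thesis by (simp add: b_def)
qed

text \<open>Moving one unit from an index above its target to an index below it never decreases the
  value: as \<open>b\<close> is balanced, the first entry is strictly larger.\<close>

lemma esym_le_balanced:
  assumes "finite I" "(\<Sum>i\<in>I. a i) = (\<Sum>i\<in>I. b i)"
    and bal: "\<And>i j. i \<in> I \<Longrightarrow> j \<in> I \<Longrightarrow> b i \<le> b j + 1"
  shows "esym I a k \<le> esym I b k"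
  using assms(2)
\<comment> \<open>The subtraction is truncated, so the measure is the total excess of
  \<open>a\<close> over \<open>b\<close>. The receiving index stays at most \<open>b j\<close> and
  contributes nothing.\<close>
proof (induction "\<Sum>i\<in>I. a i - b i" arbitrary: a rule: less_induct)
  case less
  show ?case
  proof (cases "\<exists>i\<in>I. a i > b i")
    case False
    then have le: "\<And>i. i \<in> I \<Longrightarrow> a i \<le> b i" by (meson not_le)
    have "a i = b i" if "i \<in> I" for i
    proof (rule ccontr)
      assume "a i \<noteq> b i"
      then have "(\<Sum>i\<in>I. a i) < (\<Sum>i\<in>I. b i)"
        using le that assms(1)
        by (intro sum_strict_mono_ex1) (use le_neq_implies_less in blast)+
      then show False using less.prems by simp
    qed
    then show ?thesis using esym_cong[of I a b k] by simp
  next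
    case True
    then obtain i where i: "i \<in> I" "a i > b i" by auto
    have "\<exists>j\<in>I. a j < b j"
    proof (rule ccontr)
      assume "\<not> ?thesis"
      then have "(\<Sum>i\<in>I. b i) < (\<Sum>i\<in>I. a i)"
        using i assms(1) by (intro sum_strict_mono_ex1) (auto simp: not_less)
      then show False using less.prems by simp
    qed
    then obtain j where j: "j \<in> I" "a j < b j" by auto
    have ij: "i \<noteq> j" using i j by auto
    have gt: "a i > a j" using bal[OF j(1) i(1)] i j by simp
    define a' where "a' = a(i := a i - 1, j := a j + 1)"
    have le: "a' x - b x \<le> a x - b x" for x
      using i j by (auto simp: a'_def)
    have "(\<Sum>x\<in>I. a' x - b x) < (\<Sum>x\<in>I. a x - b x)"
      using assms(1)
    proof (rule sum_strict_mono_ex1)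
      show "\<forall>x\<in>I. a' x - b x \<le> a x - b x" using le by simp
      show "\<exists>x\<in>I. a' x - b x < a x - b x" using i ij by (intro bexI[of _ i]) (auto simp: a'_def)
    qed
    moreover have "(\<Sum>x\<in>I. a' x) = (\<Sum>x\<in>I. b x)"
    proof -
      have "(\<Sum>x\<in>I - {i, j}. a' x) = (\<Sum>x\<in>I - {i, j}. a x)"
        by (rule sum.cong) (auto simp: a'_def)
      moreover have "(\<Sum>x\<in>I. c x) = c i + (c j + (\<Sum>x\<in>I - {i, j}. c x))" for c :: "'a \<Rightarrow> nat"
      proof -
        have "(\<Sum>x\<in>I. c x) = c i + (\<Sum>x\<in>I - {i}. c x)"
          using assms(1) i(1) by (rule sum.remove)
        also have "(\<Sum>x\<in>I - {i}. c x) = c j + (\<Sum>x\<in>I - {i} - {j}. c x)"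
          using assms(1) j(1) ij by (intro sum.remove) auto
        also have "I - {i} - {j} = I - {i, j}" by auto
        finally show ?thesis .
      qed
      ultimately have "(\<Sum>x\<in>I. a' x) = (\<Sum>x\<in>I. a x)"
        using ij gt by (simp add: a'_def)
      then show ?thesis using less.prems by simp
    qed
    ultimately have "esym I a' k \<le> esym I b k" by (rule less.hyps)
    moreover have "esym I a k \<le> esym I a' k"
      unfolding a'_def by (rule esym_move_unit[OF assms(1) i(1) j(1) ij gt])
    ultimately show ?thesis by simp
  qed
qed

definition transversals :: "('a \<Rightarrow> 'i) \<Rightarrow> 'a set \<Rightarrow> nat \<Rightarrow> 'a set set" where
  "transversals f V k = {S. S \<subseteq> V \<and> card S = k \<and> inj_on f S}"

lemma finite_transversals: "finite V \<Longrightarrow> finite (transversals f V k)"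
  by (rule finite_subset[of _ "Pow V"]) (auto simp: transversals_def)

text \<open>Splitting by whether the set meets the class \<open>i\<close>, and by its only vertex
  there if it does, reproduces the recursion \<open>esym_insert\<close>.\<close>

lemma card_transversals:
  assumes "finite I" "finite V" "f ` V \<subseteq> I"
  shows "card (transversals f V k) = esym I (\<lambda>i. card {v \<in> V. f v = i}) k"
  using assms
proof (induction I arbitrary: V k rule: finite_induct)
  case empty
  then have "transversals f V k = (if k = 0 then {{}} else {})" by (auto simp: transversals_def)
  then show ?case by (cases k) (simp_all add: esym_0 esym_empty)
next
  case (insert i I)
  note finV = insert.prems(1)
  show ?case
  proof (cases k)
    case 0
    have "transversals f V 0 = {{}}" using finV by (auto simp: transversals_def dest: finite_subset)
    then show ?thesis using 0 insert by (simp add: esym_0)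
  next
    case (Suc m)
    define C where "C = {v \<in> V. f v = i}"
    define W where "W = {v \<in> V. f v \<noteq> i}"
    have finW: "finite W" "finite C" and WI: "f ` W \<subseteq> I"
      using insert.prems by (auto simp: W_def C_def)
    have fib: "esym I (\<lambda>j. card {v \<in> W. f v = j}) p = esym I (\<lambda>j. card {v \<in> V. f v = j}) p" for p
      using insert.hyps(2) by (intro esym_cong arg_cong[of _ _ card]) (auto simp: W_def)
    have IH: "card (transversals f W p) = esym I (\<lambda>j. card {v \<in> V. f v = j}) p" for p
      using insert.IH[OF finW(1) WI, of p] fib by simp
    have eq: "transversals f V (Suc m)
        = transversals f W (Suc m) \<union> (\<lambda>(v, S). insert v S) ` (C \<times> transversals f W m)"
    proof (intro equalityI subsetI)
      fix S assume S: "S \<in> transversals f V (Suc m)"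
      show "S \<in> transversals f W (Suc m) \<union> (\<lambda>(v, S). insert v S) ` (C \<times> transversals f W m)"
      proof (cases "\<exists>v\<in>S. f v = i")
        case True
        then obtain v where v: "v \<in> S" "f v = i" by auto
        have "S - {v} \<in> transversals f W m"
          using S v by (auto simp: transversals_def W_def inj_on_def)
        moreover have "v \<in> C" using S v by (auto simp: transversals_def C_def)
        ultimately show ?thesis using v by (intro UnI2 image_eqI[of _ _ "(v, S - {v})"]) auto
      qed (use S in \<open>auto simp: transversals_def W_def\<close>)
    next
      fix S assume "S \<in> transversals f W (Suc m) \<union> (\<lambda>(v, S). insert v S) ` (C \<times> transversals f W m)"
      then show "S \<in> transversals f V (Suc m)"
      proof
        assume "S \<in> (\<lambda>(v, S). insert v S) ` (C \<times> transversals f W m)"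
        then obtain v T where T: "S = insert v T" "v \<in> C" "T \<in> transversals f W m" by auto
        moreover have "finite T" "v \<notin> T" using T finW
          by (auto simp: transversals_def C_def W_def dest: finite_subset)
        ultimately show ?thesis by (auto simp: transversals_def C_def W_def)
      qed (auto simp: transversals_def W_def)
    qed
    have "inj_on (\<lambda>(v, S). insert v S) (C \<times> transversals f W m)"
    proof (rule inj_onI, clarify)
      fix v S v' S'
      assume h: "v \<in> C" "S \<in> transversals f W m" "v' \<in> C" "S' \<in> transversals f W m"
        "insert v S = insert v' S'"
      then have "v \<notin> S'" "v' \<notin> S" "v \<notin> S" "v' \<notin> S'" by (auto simp: transversals_def C_def W_def)
      moreover from this h(5) have "v = v'" by blast
      ultimately show "v = v' \<and> S = S'" using h(5) insert_ident[of v S S'] by simp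
    qed
    then have "card ((\<lambda>(v, S). insert v S) ` (C \<times> transversals f W m)) = card C * card (transversals f W m)"
      by (simp add: card_image card_cartesian_product)
    moreover have "transversals f W (Suc m) \<inter> (\<lambda>(v, S). insert v S) ` (C \<times> transversals f W m) = {}"
      by (auto simp: transversals_def C_def W_def)
    ultimately have "card (transversals f V (Suc m)) = card (transversals f W (Suc m)) + card C * card (transversals f W m)"
      unfolding eq using finW by (subst card_Un_disjoint) (auto simp: finite_transversals)
    then show ?thesis
      using insert.hyps by (simp add: Suc IH esym_insert C_def)
  qed
qed

section \<open>Cliques and expansions in hypergraphs\<close>

definition hcliques :: "nat \<Rightarrow> nat \<Rightarrow> 'a hypergraph \<Rightarrow> 'a set set" where
  "hcliques r s G = {S. S \<subseteq> verts G \<and> card S = s \<and> {e. e \<subseteq> S \<and> card e = r} \<subseteq> hedges G}"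

lemma finite_hcliques: "rgraph r G \<Longrightarrow> finite (hcliques r s G)"
  by (rule finite_subset[of _ "Pow (verts G)"]) (auto simp: hcliques_def rgraph_def)

lemma image_subsets_of_card:
  assumes "bij_betw f A B"
  shows "(\<lambda>e. f ` e) ` {e. e \<subseteq> A \<and> card e = r} = {e. e \<subseteq> B \<and> card e = r}"
proof (intro equalityI subsetI)
  fix e assume "e \<in> (\<lambda>e. f ` e) ` {e. e \<subseteq> A \<and> card e = r}"
  then obtain d where "e = f ` d" "d \<subseteq> A" "card d = r" by auto
  then show "e \<in> {e. e \<subseteq> B \<and> card e = r}"
    using assms by (auto simp: bij_betw_def card_image inj_on_subset)
next
  fix e assume "e \<in> {e. e \<subseteq> B \<and> card e = r}"
  then obtain d where "d \<subseteq> A" "e = f ` d" "card e = r"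
    using assms by (auto simp: bij_betw_def subset_image_iff)
  then show "e \<in> (\<lambda>e. f ` e) ` {e. e \<subseteq> A \<and> card e = r}"
    using assms by (auto simp: bij_betw_def card_image inj_on_subset intro!: image_eqI[of _ _ d])
qed

text \<open>A copy contains all \<open>r\<close>-subsets of its vertex set and is determined by that
  set, so unlabelled copies can be counted as vertex sets.\<close>

lemma num_copies_complete_rgraph:
  assumes "rgraph r G"
  shows "num_copies (complete_rgraph r s) G = card (hcliques r s G)"
proof -
  have "copies (complete_rgraph r s) G = (\<lambda>S. HG S {e. e \<subseteq> S \<and> card e = r}) ` hcliques r s G"
  proof (intro equalityI subsetI)
    fix H assume H: "H \<in> copies (complete_rgraph r s) G"
    then obtain f where f: "bij_betw f {..<s} (verts H)"
      "(\<lambda>e. f ` e) ` {e. e \<subseteq> {..<s} \<and> card e = r} = hedges H"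
      by (auto simp: copies_def hg_iso_def complete_rgraph_def)
    then have "hedges H = {e. e \<subseteq> verts H \<and> card e = r}" using image_subsets_of_card[OF f(1), of r] by simp
    moreover have "card (verts H) = s" using bij_betw_same_card[OF f(1)] by simp
    ultimately show "H \<in> (\<lambda>S. HG S {e. e \<subseteq> S \<and> card e = r}) ` hcliques r s G"
      using H by (intro image_eqI[of _ _ "verts H"])
        (auto simp: copies_def subhypergraph_def hcliques_def intro: hypergraph.expand)
  next
    fix H assume "H \<in> (\<lambda>S. HG S {e. e \<subseteq> S \<and> card e = r}) ` hcliques r s G"
    then obtain S where S: "S \<in> hcliques r s G" "H = HG S {e. e \<subseteq> S \<and> card e = r}" by auto
    then have "finite S" using assms by (auto simp: hcliques_def rgraph_def dest: finite_subset)
    then obtain f where f: "bij_betw f {..<s} S"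
      using S bij_betw_iff_card[of "{..<s}" S] by (auto simp: hcliques_def)
    then have "hg_iso (complete_rgraph r s) H"
      using image_subsets_of_card[OF f, of r] by (auto simp: hg_iso_def complete_rgraph_def S)
    then show "H \<in> copies (complete_rgraph r s) G"
      using S by (auto simp: copies_def subhypergraph_def hcliques_def)
  qed
  moreover have "inj_on (\<lambda>S. HG S {e. e \<subseteq> S \<and> card e = r}) (hcliques r s G)"
    by (auto simp: inj_on_def)
  ultimately show ?thesis by (simp add: num_copies_def card_image)
qed

lemma embedding_not_hg_free:
  assumes "inj_on f (verts F)" "f ` verts F \<subseteq> verts G"
    and "\<And>e. e \<in> hedges F \<Longrightarrow> e \<subseteq> verts F \<and> f ` e \<in> hedges G"
  shows "\<not> hg_free F G"
proof -
  have "HG (f ` verts F) ((\<lambda>e. f ` e) ` hedges F) \<in> copies F G"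
    using assms by (fastforce simp: copies_def subhypergraph_def hg_iso_def bij_betw_def)
  then show ?thesis by (auto simp: hg_free_def)
qed

text \<open>Each \<open>E p - K\<close> has \<open>r - 2\<close> vertices and these sets are
  pairwise disjoint, so they can serve as images of the new vertices of the expansion.\<close>

lemma expanded_clique_not_hg_free:
  assumes G: "rgraph r G" and K: "K \<subseteq> verts G" "card K = m"
    and E: "\<And>p. p \<subseteq> K \<Longrightarrow> card p = 2 \<Longrightarrow> E p \<in> hedges G \<and> E p \<inter> K = p"
    and disj: "\<And>p q. p \<subseteq> K \<Longrightarrow> card p = 2 \<Longrightarrow> q \<subseteq> K \<Longrightarrow> card q = 2 \<Longrightarrow> p \<noteq> q \<Longrightarrow> E p \<inter> E q \<subseteq> K"
  shows "\<not> hg_free (expansion r (complete_rgraph 2 m)) G"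
proof -
  have finG: "finite (verts G)" using G by (simp add: rgraph_def)
  have finK: "finite K" using finG K finite_subset by blast
  then obtain c where c: "bij_betw c {..<m} K"
    using K(2) bij_betw_iff_card[of "{..<m}" K] by auto
  have "\<exists>h. bij_betw h {..<r - 2} (E p - K)" if p: "p \<subseteq> K" "card p = 2" for p
  proof -
    have e: "E p \<subseteq> verts G" "card (E p) = r" using E[OF p] G by (auto simp: rgraph_def)
    have fe: "finite (E p)" using e finG finite_subset by blast
    have "E p - K = E p - p" using E[OF p] by auto
    moreover have "p \<subseteq> E p" using E[OF p] by auto
    ultimately have "card (E p - K) = r - 2" using e(2) p(2) fe
      by (simp add: card_Diff_subset finite_subset)
    then show ?thesis using fe bij_betw_iff_card[of "{..<r - 2}" "E p - K"] by simp
  qed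
  then obtain h where h: "\<And>p. p \<subseteq> K \<Longrightarrow> card p = 2 \<Longrightarrow> bij_betw (h p) {..<r - 2} (E p - K)"
    by metis
  define P where "P = {e. e \<subseteq> {..<m} \<and> card e = 2}"
  have cP: "c ` e \<subseteq> K" "card (c ` e) = 2" if "e \<in> P" for e
    using that c by (auto simp: P_def bij_betw_def card_image inj_on_subset)
  have cinj: "c ` e = c ` d \<Longrightarrow> e = d" if "e \<in> P" "d \<in> P" for e d
    using that c by (auto simp: P_def bij_betw_def inj_on_image_eq_iff)
  have hP: "bij_betw (h (c ` e)) {..<r - 2} (E (c ` e) - K)" if "e \<in> P" for e
    using h cP[OF that] by blast
  have ck: "c i \<in> K" if "i < m" for i using c that by (auto simp: bij_betw_def)
  have hk: "h (c ` e) k \<in> E (c ` e) - K" if "e \<in> P" "k < r - 2" for e k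
    using hP[OF that(1)] that(2) by (auto simp: bij_betw_def)
  define f where "f x = (case x of Inl i \<Rightarrow> c i | Inr (e, k) \<Rightarrow> h (c ` e) k)" for x
  let ?F = "expansion r (complete_rgraph 2 m)"
  have vF: "verts ?F = Inl ` {..<m} \<union> Inr ` (P \<times> {..<r - 2})"
    and hF: "hedges ?F = (\<lambda>e. Inl ` e \<union> Inr ` ({e} \<times> {..<r - 2})) ` P"
    by (auto simp: expansion_def complete_rgraph_def P_def)
  show ?thesis
  proof (rule embedding_not_hg_free[where f = f])
    show "inj_on f (verts ?F)"
    proof (rule inj_onI)
      fix x y assume x: "x \<in> verts ?F" and y: "y \<in> verts ?F" and xy: "f x = f y"
      consider (1) i j where "x = Inl i" "y = Inl j" "i < m" "j < m"
        | (2) i e k where "x = Inl i" "y = Inr (e, k)" "i < m" "e \<in> P" "k < r - 2"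
        | (3) i e k where "y = Inl i" "x = Inr (e, k)" "i < m" "e \<in> P" "k < r - 2"
        | (4) d j e k where "x = Inr (d, j)" "y = Inr (e, k)" "d \<in> P" "j < r - 2" "e \<in> P" "k < r - 2"
        using x y unfolding vF by blast
      then show "x = y"
      proof cases
        case 1
        then show ?thesis using c xy by (auto simp: f_def bij_betw_def inj_on_def)
      next
        case 2
        then show ?thesis using ck[of i] hk[of e k] xy by (auto simp: f_def)
      next
        case 3
        then show ?thesis using ck[of i] hk[of e k] xy by (auto simp: f_def)
      next
        case 4
        then have eq: "h (c ` d) j = h (c ` e) k" using xy by (simp add: f_def)
        have "d = e"
        proof (rule ccontr)
          assume "d \<noteq> e"
          then have "c ` d \<noteq> c ` e" using cinj 4 by blast
          then have "E (c ` d) \<inter> E (c ` e) \<subseteq> K" using disj cP 4 by blast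
          then show False using hk[of d j] hk[of e k] 4 eq by auto
        qed
        moreover have "j = k" using hP[of d] 4 eq \<open>d = e\<close> by (auto simp: bij_betw_def inj_on_def)
        ultimately show ?thesis using 4 by simp
      qed
    qed
    show "f ` verts ?F \<subseteq> verts G"
    proof -
      have "E (c ` e) \<subseteq> verts G" if "e \<in> P" for e
        using E[OF cP[OF that]] G by (auto simp: rgraph_def)
      then have "h (c ` e) k \<in> verts G" if "e \<in> P" "k < r - 2" for e k
        using hk[OF that] that by blast
      moreover have "c i \<in> verts G" if "i < m" for i using ck[OF that] K by blast
      ultimately show ?thesis unfolding vF by (auto simp: f_def)
    qed
    fix d assume "d \<in> hedges ?F"
    then obtain e where e: "e \<in> P" "d = Inl ` e \<union> Inr ` ({e} \<times> {..<r - 2})" unfolding hF by auto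
    have d: "d = Inl ` e \<union> (\<lambda>k. Inr (e, k)) ` {..<r - 2}" unfolding e(2) by auto
    have "f ` d = c ` e \<union> h (c ` e) ` {..<r - 2}"
      unfolding d by (simp add: image_Un image_image f_def)
    also have "h (c ` e) ` {..<r - 2} = E (c ` e) - K" using hP[OF e(1)] by (simp add: bij_betw_def)
    also have "c ` e \<union> (E (c ` e) - K) = E (c ` e)" using E[OF cP[OF e(1)]] by auto
    finally show "d \<subseteq> verts ?F \<and> f ` d \<in> hedges G"
      using E[OF cP[OF e(1)]] e vF by (auto simp: P_def)
  qed
qed

section \<open>Thick pairs\<close>

definition codegree :: "'a hypergraph \<Rightarrow> 'a \<Rightarrow> 'a \<Rightarrow> nat" where
  "codegree G u v = card {e \<in> hedges G. u \<in> e \<and> v \<in> e}"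

text \<open>At most \<open>n ^ (r - 3)\<close> edges contain three given vertices. Above
  \<open>m\<close> times this bound, \<open>m\<close> vertices cannot block all edges through the
  pair; at or below it, a thin pair lies in few edges and therefore in few cliques.\<close>

definition thick :: "nat \<Rightarrow> nat \<Rightarrow> 'a hypergraph \<Rightarrow> 'a \<Rightarrow> 'a \<Rightarrow> bool" where
  "thick m r G u v \<longleftrightarrow> u \<noteq> v \<and> codegree G u v > m * card (verts G) ^ (r - 3)"

lemma thick_sym: "thick m r G u v \<Longrightarrow> thick m r G v u"
  by (auto simp: thick_def codegree_def conj_commute)

lemma thick_irrefl: "\<not> thick m r G u u"
  by (simp add: thick_def)

lemma card_supersets_le:
  assumes "finite V" "A \<subseteq> V"
  shows "card {S. A \<subseteq> S \<and> S \<subseteq> V \<and> card S = k} \<le> card V ^ (k - card A)"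
proof -
  let ?T = "{T. T \<subseteq> V \<and> card T = k - card A}"
  have "card {S. A \<subseteq> S \<and> S \<subseteq> V \<and> card S = k} \<le> card ?T"
  proof (rule card_inj_on_le[where f = "\<lambda>S. S - A"])
    show "inj_on (\<lambda>S. S - A) {S. A \<subseteq> S \<and> S \<subseteq> V \<and> card S = k}"
      by (auto simp: inj_on_def)
    show "(\<lambda>S. S - A) ` {S. A \<subseteq> S \<and> S \<subseteq> V \<and> card S = k} \<subseteq> ?T"
      using assms by (auto simp: card_Diff_subset finite_subset)
  qed (use assms in simp)
  also have "\<dots> = card V choose (k - card A)" using n_subsets[OF assms(1)] by simp
  also have "\<dots> \<le> card V ^ (k - card A)"
    by (cases "k - card A \<le> card V") (auto simp: binomial_le_pow binomial_eq_0)
  finally show ?thesis .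
qed

lemma thick_obtains_edge:
  assumes G: "rgraph r G" and uv: "thick m r G u v" "u \<in> W" "v \<in> W"
    and W: "W \<subseteq> verts G" "card W \<le> m"
  obtains e where "e \<in> hedges G" "e \<inter> W = {u, v}"
proof -
  have finV: "finite (verts G)" using G by (simp add: rgraph_def)
  have finW: "finite W" using W finV finite_subset by blast
  let ?A = "{e \<in> hedges G. u \<in> e \<and> v \<in> e}"
  let ?B = "\<Union>w\<in>W - {u, v}. {S. {u, v, w} \<subseteq> S \<and> S \<subseteq> verts G \<and> card S = r}"
  have finB: "finite ?B"
    by (rule finite_subset[of _ "Pow (verts G)"]) (use finV in auto)
  have "card ?B \<le> (\<Sum>w\<in>W - {u, v}. card {S. {u, v, w} \<subseteq> S \<and> S \<subseteq> verts G \<and> card S = r})"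
    using finW by (intro card_UN_le) auto
  also have "\<dots> \<le> (\<Sum>w\<in>W - {u, v}. card (verts G) ^ (r - 3))"
  proof (intro sum_mono)
    fix w assume w: "w \<in> W - {u, v}"
    have "u \<noteq> v" using uv by (simp add: thick_def)
    then have "card {u, v, w} = 3" using w by auto
    then show "card {S. {u, v, w} \<subseteq> S \<and> S \<subseteq> verts G \<and> card S = r} \<le> card (verts G) ^ (r - 3)"
      using card_supersets_le[OF finV, of "{u, v, w}" r] w uv W by auto
  qed
  also have "\<dots> \<le> m * card (verts G) ^ (r - 3)"
    using W(2) card_mono[OF finW, of "W - {u, v}"] by (auto intro!: mult_right_mono)
  also have "\<dots> < card ?A" using uv by (simp add: thick_def codegree_def)
  finally have "\<not> ?A \<subseteq> ?B" using card_mono[OF finB, of ?A] by linarith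
  then obtain e where e: "e \<in> ?A" "e \<notin> ?B" by blast
  then have "e \<subseteq> verts G" "card e = r" using G by (auto simp: rgraph_def)
  then have "e \<inter> W = {u, v}" using e uv by auto
  then show thesis using that e by auto
qed

text \<open>A generous bound on the vertices occupied by a partial expansion: the
  \<open>Suc l\<close> core vertices and \<open>r\<close> for each of the edges, whose core vertices
  are thus counted again.\<close>

definition expansion_bound :: "nat \<Rightarrow> nat \<Rightarrow> nat" where
  "expansion_bound r l = Suc l + (Suc l choose 2) * r"

text \<open>Only one edge through the pair \<open>p0\<close> is required; all other pairs are expanded greedily,
  each thick pair having an edge that avoids everything chosen before.\<close>

lemma greedy_expansion:
  assumes G: "rgraph r G" and K: "K \<subseteq> verts G" "card K = Suc l"
    and p0: "p0 \<subseteq> K" "card p0 = 2" and e0: "e0 \<in> hedges G" "e0 \<inter> K = p0"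
    and thick: "\<And>u v. u \<in> K \<Longrightarrow> v \<in> K \<Longrightarrow> u \<noteq> v \<Longrightarrow> {u, v} \<noteq> p0 \<Longrightarrow> thick (expansion_bound r l) r G u v"
  shows "\<not> hg_free (expansion r (complete_rgraph 2 (Suc l))) G"
proof -
  have finV: "finite (verts G)" using G by (simp add: rgraph_def)
  have finK: "finite K" using K finV finite_subset by blast
  define P where "P = {p. p \<subseteq> K \<and> card p = 2}"
  have finP: "finite P" using finK by (auto simp: P_def)
  have cP: "card P = Suc l choose 2" using n_subsets[OF finK, of 2] K by (simp add: P_def)
  \<comment> \<open>Only pairs other than \<open>p0\<close> are removed, so the recursion ends at
    \<open>{p0}\<close>, where \<open>e0\<close> is used. Every later edge is then chosen to avoid
    \<open>e0\<close> outside \<open>K\<close>.\<close>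
  have "Q \<subseteq> P \<Longrightarrow> p0 \<in> Q \<Longrightarrow> \<exists>E. (\<forall>p\<in>Q. E p \<in> hedges G \<and> E p \<inter> K = p)
      \<and> (\<forall>p\<in>Q. \<forall>q\<in>Q. p \<noteq> q \<longrightarrow> E p \<inter> E q \<subseteq> K)" if "finite Q" for Q
    using that
  proof (induction Q rule: finite_remove_induct)
    case (remove Q)
    show ?case
    proof (cases "Q = {p0}")
      case True
      then show ?thesis using e0 by (intro exI[of _ "\<lambda>_. e0"]) auto
    next
      case False
      then obtain p where p: "p \<in> Q" "p \<noteq> p0" using remove.prems by blast
      define R where "R = Q - {p}"
      have "\<exists>E. (\<forall>p\<in>R. E p \<in> hedges G \<and> E p \<inter> K = p)
          \<and> (\<forall>p\<in>R. \<forall>q\<in>R. p \<noteq> q \<longrightarrow> E p \<inter> E q \<subseteq> K)"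
        unfolding R_def using remove.prems p by (intro remove.IH) auto
      then obtain E where E0: "\<forall>p\<in>R. E p \<in> hedges G \<and> E p \<inter> K = p"
        "\<forall>p\<in>R. \<forall>q\<in>R. p \<noteq> q \<longrightarrow> E p \<inter> E q \<subseteq> K" by (elim exE conjE)
      have E: "p \<in> R \<Longrightarrow> E p \<in> hedges G \<and> E p \<inter> K = p"
        "p \<in> R \<Longrightarrow> q \<in> R \<Longrightarrow> p \<noteq> q \<Longrightarrow> E p \<inter> E q \<subseteq> K" for p q
        using E0 by simp_all
      have RP: "R \<subseteq> P" "finite R" using remove.prems finP by (auto simp: R_def intro: finite_subset)
      define W where "W = K \<union> (\<Union>q\<in>R. E q)"
      have "card p = 2" "p \<subseteq> K" using p remove.prems by (auto simp: P_def)
      then obtain u v where uv: "p = {u, v}" "u \<noteq> v" "u \<in> K" "v \<in> K"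
        by (auto simp: card_2_iff)
      have "card W \<le> card K + (\<Sum>q\<in>R. card (E q))"
        unfolding W_def using RP by (intro order_trans[OF card_Un_le] add_left_mono card_UN_le)
      also have "(\<Sum>q\<in>R. card (E q)) = (\<Sum>q\<in>R. r)"
        using E(1) G by (intro sum.cong) (auto simp: rgraph_def)
      also have "card K + (\<Sum>q\<in>R. r) \<le> expansion_bound r l"
        using card_mono[OF finP RP(1)] K(2) cP by (simp add: expansion_bound_def)
      finally have "card W \<le> expansion_bound r l" .
      moreover have "W \<subseteq> verts G" using K E(1) G by (auto simp: W_def rgraph_def)
      moreover have "thick (expansion_bound r l) r G u v" using thick uv p by auto
      ultimately obtain e where e: "e \<in> hedges G" "e \<inter> W = {u, v}"
        using thick_obtains_edge[OF G, of "expansion_bound r l" u v W] uv by (auto simp: W_def)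
      have eK: "e \<inter> K = p" using e uv by (auto simp: W_def)
      have eE: "e \<inter> E q \<subseteq> K" "E q \<inter> e \<subseteq> K" if "q \<in> R" for q
        using e uv that by (auto simp: W_def)
      show ?thesis
      proof (intro exI[of _ "E(p := e)"] conjI ballI impI)
        fix q assume "q \<in> Q"
        then show "(E(p := e)) q \<in> hedges G" "(E(p := e)) q \<inter> K = q"
          using E(1)[of q] e eK by (auto simp: R_def)
      next
        fix q q' assume "q \<in> Q" "q' \<in> Q" "q \<noteq> q'"
        then show "(E(p := e)) q \<inter> (E(p := e)) q' \<subseteq> K"
          using E(2)[of q q'] eE[of q] eE[of q'] by (auto simp: R_def)
      qed
    qed
  qed simp
  moreover have "p0 \<in> P" using p0 by (simp add: P_def)
  ultimately have "\<exists>E. (\<forall>p\<in>P. E p \<in> hedges G \<and> E p \<inter> K = p)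
      \<and> (\<forall>p\<in>P. \<forall>q\<in>P. p \<noteq> q \<longrightarrow> E p \<inter> E q \<subseteq> K)"
    using finP by simp
  then obtain E where E: "\<forall>p\<in>P. E p \<in> hedges G \<and> E p \<inter> K = p"
    "\<forall>p\<in>P. \<forall>q\<in>P. p \<noteq> q \<longrightarrow> E p \<inter> E q \<subseteq> K" by (elim exE conjE)
  show ?thesis
    by (rule expanded_clique_not_hg_free[OF G K, of E]) (use E in \<open>auto simp: P_def\<close>)
qed

text \<open>Any pair of a thick clique can play the role of \<open>p0\<close>, its own thickness
  supplying the edge \<open>e0\<close>.\<close>

lemma no_thick_cliques:
  assumes G: "rgraph r G" and free: "hg_free (expansion r (complete_rgraph 2 (Suc l))) G" and l: "l \<ge> 1"
  shows "kcliques (thick (expansion_bound r l) r G) (verts G) (Suc l) = {}"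
proof (rule ccontr)
  assume "\<not> ?thesis"
  then obtain K where K: "K \<subseteq> verts G" "card K = Suc l" and pw: "pairwise (thick (expansion_bound r l) r G) K"
    by (auto simp: kcliques_def)
  have "2 \<le> card K" using K l by simp
  then obtain p0 where p0: "p0 \<subseteq> K" "card p0 = 2"
    by (meson obtain_subset_with_card_n)
  then obtain u v where uv: "p0 = {u, v}" "u \<noteq> v" by (auto simp: card_2_iff)
  then obtain e0 where "e0 \<in> hedges G" "e0 \<inter> K = {u, v}"
    using thick_obtains_edge[OF G, of "expansion_bound r l" u v K] K pw p0
    by (auto simp: pairwise_def expansion_bound_def)
  then show False
    using greedy_expansion[OF G K p0, of e0] uv pw free by (auto simp: pairwise_def)
qed

lemma subset_of_card_containing_pair:
  assumes "finite S" "x \<in> S" "y \<in> S" "x \<noteq> y" "2 \<le> r" "r \<le> card S"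
  obtains e where "e \<subseteq> S" "card e = r" "x \<in> e" "y \<in> e"
proof -
  have "\<exists>e. {x, y} \<subseteq> e \<and> e \<subseteq> S \<and> card e = r"
    using assms by (intro exists_subset_between) auto
  then show thesis using that by auto
qed

text \<open>Suppose \<open>e0\<close> contains \<open>x\<close> and \<open>y\<close>. One vertex
  from each of the other \<open>l - 1\<close> classes, outside \<open>e0\<close>, completes them to
  \<open>Suc l\<close> vertices whose pairs are all thick except possibly \<open>{x, y}\<close>, and
  \<open>e0\<close> expands that pair. In the class size, \<open>l * t\<close> pays for the greedy
  choice, \<open>2 * t\<close> for the non-neighbours of \<open>x\<close> and \<open>y\<close>, and
  \<open>r\<close> for the vertices of \<open>e0\<close>.\<close>

lemma same_class_uncovered:
  fixes t :: real and G :: "'a hypergraph" and r l :: nat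
  defines "D \<equiv> thick (expansion_bound r l) r G"
  assumes G: "rgraph r G" and free: "hg_free (expansion r (complete_rgraph 2 (Suc l))) G"
    and U: "U \<subseteq> verts G" "f ` U \<subseteq> {..<l}" and t: "t \<ge> 0"
    and miss: "\<And>u. u \<in> U \<Longrightarrow> real (card {w \<in> U. f w \<noteq> f u \<and> \<not> D u w}) \<le> t"
    and size: "\<And>i. i < l \<Longrightarrow> real (card {u \<in> U. f u = i}) > (real l + 2) * t + real r"
    and xy: "x \<in> U" "y \<in> U" "x \<noteq> y" "f x = f y" and e0: "e0 \<in> hedges G"
  shows "\<not> {x, y} \<subseteq> e0"
proof
  assume sub: "{x, y} \<subseteq> e0"
  have finV: "finite (verts G)" using G by (simp add: rgraph_def)
  have finU: "finite U" using U finV finite_subset by blast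
  have sym: "\<And>u v. D u v \<Longrightarrow> D v u" and irr: "\<And>u. \<not> D u u"
    by (auto simp: D_def thick_irrefl intro: thick_sym)
  have e0V: "finite e0" "card e0 = r" using e0 G finV by (auto simp: rgraph_def intro: finite_subset)
  define I where "I = {..<l} - {f x}"
  define X where "X j = {w \<in> U. f w = j \<and> w \<notin> e0 \<and> D x w \<and> D y w}" for j
  have fx: "f x < l" using xy U by auto
  have "\<exists>w. (\<forall>i\<in>I. w i \<in> X i) \<and> (\<forall>i\<in>I. \<forall>j\<in>I. i \<noteq> j \<longrightarrow> D (w i) (w j))"
  proof (rule greedy_transversal[of D _ l t, OF sym])
    show "finite I" "card I \<le> Suc l" using card_mono[of "{..<l}" I] by (auto simp: I_def)
  next
    fix j assume j: "j \<in> I"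
    let ?M = "\<lambda>z. {w \<in> U. f w \<noteq> f z \<and> \<not> D z w}"
    have "{u \<in> U. f u = j} \<subseteq> X j \<union> (e0 \<union> (?M x \<union> ?M y))"
      using j xy by (auto simp: X_def I_def)
    then have "card {u \<in> U. f u = j} \<le> card (X j \<union> (e0 \<union> (?M x \<union> ?M y)))"
      using finU e0V by (intro card_mono) (auto simp: X_def)
    also have "\<dots> \<le> card (X j) + (card e0 + (card (?M x) + card (?M y)))"
      by (intro order_trans[OF card_Un_le] add_left_mono) simp
    finally have "real (card {u \<in> U. f u = j}) \<le> real (card (X j)) + real r + real (card (?M x)) + real (card (?M y))"
      using e0V by simp
    moreover have "real (card {u \<in> U. f u = j}) > real l * t + 2 * t + real r"
      using size[of j] j by (auto simp: I_def algebra_simps)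
    ultimately show "finite (X j) \<and> real l * t < real (card (X j))"
      using finU miss[OF xy(1)] miss[OF xy(2)] by (auto simp: X_def)
  next
    fix i j z assume ij: "i \<in> I" "j \<in> I" "i \<noteq> j" "z \<in> X i"
    have "card {y \<in> X j. \<not> D z y} \<le> card {w \<in> U. f w \<noteq> f z \<and> \<not> D z w}"
      using finU ij by (intro card_mono) (auto simp: X_def)
    then show "real (card {y \<in> X j. \<not> D z y}) \<le> t"
      using miss[of z] ij by (auto simp: X_def)
  qed (use t in auto)
  then obtain w where w0: "\<forall>i\<in>I. w i \<in> X i" "\<forall>i\<in>I. \<forall>j\<in>I. i \<noteq> j \<longrightarrow> D (w i) (w j)" by (elim exE conjE)
  have w: "w i \<in> U" "w i \<notin> e0" "D x (w i)" "D y (w i)" "D (w i) x" "D (w i) y" if "i \<in> I" for i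
    using w0(1) that sym by (auto simp: X_def)
  have wD: "D (w i) (w j)" if "i \<in> I" "j \<in> I" "w i \<noteq> w j" for i j using w0(2) that by metis
  have winj: "inj_on w I" using w0(2) irr by (intro inj_onI) metis
  define K where "K = insert x (insert y (w ` I))"
  have "x \<notin> w ` I" "y \<notin> w ` I" using w(2) sub by auto
  moreover have "finite I" "card I = l - 1" using fx by (auto simp: I_def)
  ultimately have "card K = Suc l" using xy fx winj by (simp add: K_def card_image)
  moreover have "K \<subseteq> verts G" using U xy w(1) by (auto simp: K_def)
  moreover have "e0 \<inter> K = {x, y}" using sub w(2) by (auto simp: K_def)
  moreover have "D u v" if "u \<in> K" "v \<in> K" "u \<noteq> v" "{u, v} \<noteq> {x, y}" for u v
    using that w wD by (auto simp: K_def)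
  ultimately have "\<not> hg_free (expansion r (complete_rgraph 2 (Suc l))) G"
    using G xy e0 by (intro greedy_expansion[of r G K l "{x, y}" e0]) (auto simp: K_def D_def)
  then show False using free by simp
qed

section \<open>Counting cliques that contain a thin pair\<close>

text \<open>Since \<open>r \<le> s\<close>, every such clique contains an edge through the pair;
  there are at most \<open>m * n ^ (r - 3)\<close> edges of this kind, each with at most
  \<open>n ^ (s - r)\<close> extensions. This saves a factor of order \<open>n\<close> over the
  trivial bound \<open>n ^ (s - 2)\<close>.\<close>

lemma card_hcliques_thin_pair:
  assumes G: "rgraph r G" and rs: "3 \<le> r" "r \<le> s" and xy: "x \<noteq> y" "\<not> thick m r G x y"
  shows "card {S \<in> hcliques r s G. x \<in> S \<and> y \<in> S} \<le> m * card (verts G) ^ (s - 3)"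
proof -
  let ?n = "card (verts G)" and ?A = "{e \<in> hedges G. x \<in> e \<and> y \<in> e}"
  have finV: "finite (verts G)" using G by (simp add: rgraph_def)
  have finA: "finite ?A"
    by (rule finite_subset[of _ "Pow (verts G)"]) (use G finV in \<open>auto simp: rgraph_def\<close>)
  have "{S \<in> hcliques r s G. x \<in> S \<and> y \<in> S} \<subseteq> (\<Union>e\<in>?A. {S. e \<subseteq> S \<and> S \<subseteq> verts G \<and> card S = s})"
  proof
    fix S assume S: "S \<in> {S \<in> hcliques r s G. x \<in> S \<and> y \<in> S}"
    then have "finite S" "card S = s" using finV by (auto simp: hcliques_def dest: finite_subset)
    then obtain e where "e \<subseteq> S" "card e = r" "x \<in> e" "y \<in> e"
      using subset_of_card_containing_pair[of S x y r] S xy rs by auto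
    then show "S \<in> (\<Union>e\<in>?A. {S. e \<subseteq> S \<and> S \<subseteq> verts G \<and> card S = s})"
      using S by (auto simp: hcliques_def intro!: bexI[of _ e])
  qed
  then have "card {S \<in> hcliques r s G. x \<in> S \<and> y \<in> S} \<le> card (\<Union>e\<in>?A. {S. e \<subseteq> S \<and> S \<subseteq> verts G \<and> card S = s})"
    using finV by (intro card_mono finite_subset[of "\<Union>e\<in>?A. {S. e \<subseteq> S \<and> S \<subseteq> verts G \<and> card S = s}" "Pow (verts G)"]) auto
  also have "\<dots> \<le> (\<Sum>e\<in>?A. card {S. e \<subseteq> S \<and> S \<subseteq> verts G \<and> card S = s})"
    by (rule card_UN_le[OF finA])
  also have "\<dots> \<le> (\<Sum>e\<in>?A. ?n ^ (s - r))"
  proof (intro sum_mono)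
    fix e assume "e \<in> ?A"
    then have "e \<subseteq> verts G" "card e = r" using G by (auto simp: rgraph_def)
    then show "card {S. e \<subseteq> S \<and> S \<subseteq> verts G \<and> card S = s} \<le> ?n ^ (s - r)"
      using card_supersets_le[OF finV, of e s] by simp
  qed
  also have "\<dots> \<le> (m * ?n ^ (r - 3)) * ?n ^ (s - r)"
    using xy by (auto simp: thick_def codegree_def intro!: mult_right_mono)
  also have "\<dots> = m * ?n ^ (s - 3)"
    using rs by (simp add: mult.assoc flip: power_add)
  finally show ?thesis .
qed

definition thin_cliques :: "nat \<Rightarrow> nat \<Rightarrow> nat \<Rightarrow> 'a hypergraph \<Rightarrow> 'a set set" where
  "thin_cliques m r s G = {S \<in> hcliques r s G. \<not> pairwise (thick m r G) S}"

lemma finite_thin_cliques: "rgraph r G \<Longrightarrow> finite (thin_cliques m r s G)"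
  by (simp add: thin_cliques_def finite_hcliques)

lemma card_thin_cliques_le:
  assumes G: "rgraph r G" and rs: "3 \<le> r" "r \<le> s"
  shows "card (thin_cliques m r s G) \<le> m * card (verts G) ^ (s - 1)"
proof -
  let ?n = "card (verts G)"
  let ?P = "{p \<in> verts G \<times> verts G. fst p \<noteq> snd p \<and> \<not> thick m r G (fst p) (snd p)}"
  have finV: "finite (verts G)" using G by (simp add: rgraph_def)
  have cP: "card ?P \<le> ?n * ?n"
    using card_mono[of "verts G \<times> verts G" ?P] finV by (auto simp: card_cartesian_product)
  have "thin_cliques m r s G \<subseteq> (\<Union>p\<in>?P. {S \<in> hcliques r s G. fst p \<in> S \<and> snd p \<in> S})"
  proof
    fix S assume S: "S \<in> thin_cliques m r s G"
    then obtain x y where "x \<in> S" "y \<in> S" "x \<noteq> y" "\<not> thick m r G x y"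
      by (auto simp: thin_cliques_def pairwise_def)
    moreover have "S \<in> hcliques r s G" "S \<subseteq> verts G" using S by (auto simp: thin_cliques_def hcliques_def)
    ultimately show "S \<in> (\<Union>p\<in>?P. {S \<in> hcliques r s G. fst p \<in> S \<and> snd p \<in> S})"
      by (intro UN_I[of "(x, y)"]) auto
  qed
  then have "card (thin_cliques m r s G) \<le> card (\<Union>p\<in>?P. {S \<in> hcliques r s G. fst p \<in> S \<and> snd p \<in> S})"
    using finV finite_hcliques[OF G] by (intro card_mono) auto
  also have "\<dots> \<le> (\<Sum>p\<in>?P. card {S \<in> hcliques r s G. fst p \<in> S \<and> snd p \<in> S})"
    using finV by (intro card_UN_le) auto
  also have "\<dots> \<le> (\<Sum>p\<in>?P. m * ?n ^ (s - 3))"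
    using card_hcliques_thin_pair[OF G rs] by (intro sum_mono) auto
  also have "\<dots> \<le> (?n * ?n) * (m * ?n ^ (s - 3))"
    using mult_right_mono[OF cP, of "m * ?n ^ (s - 3)"] by simp
  also have "\<dots> = m * ?n ^ (s - 1)"
  proof -
    have "s - 1 = Suc (Suc (s - 3))" using rs by simp
    then show ?thesis by simp
  qed
  finally show ?thesis .
qed

text \<open>Markov's inequality for the incidences of vertices and thin cliques. The point is that
  the bound does not depend on the number of vertices.\<close>

lemma card_thin_exceptional_le:
  fixes \<beta> :: real and G :: "'a hypergraph" and m :: nat
  assumes G: "rgraph r G" and rs: "3 \<le> r" "r \<le> s" and \<beta>: "\<beta> > 0"
  defines "B \<equiv> {v \<in> verts G. real (card {S \<in> thin_cliques m r s G. v \<in> S}) > \<beta> * real (card (verts G)) ^ (s - 1)}"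
  shows "real (card B) \<le> real s * real m / \<beta>"
proof (cases "verts G = {}")
  case True
  then show ?thesis using \<beta> by (simp add: B_def)
next
  case False
  let ?T = "thin_cliques m r s G" and ?n = "real (card (verts G))"
  have finV: "finite (verts G)" using G by (simp add: rgraph_def)
  have n: "?n > 0" using False finV by (simp add: card_gt_0_iff)
  have finB: "finite B" using finV by (simp add: B_def)
  have finT: "finite ?T" by (rule finite_thin_cliques[OF G])
  have "real (card B) * (\<beta> * ?n ^ (s - 1)) = (\<Sum>v\<in>B. \<beta> * ?n ^ (s - 1))" by simp
  also have "\<dots> \<le> (\<Sum>v\<in>B. real (card {S \<in> ?T. v \<in> S}))"
    by (intro sum_mono) (auto simp: B_def)
  also have "\<dots> \<le> (\<Sum>v\<in>verts G. real (card {S \<in> ?T. v \<in> S}))"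
    using finV by (intro sum_mono2) (auto simp: B_def)
  also have "\<dots> = (\<Sum>v\<in>verts G. \<Sum>S | S \<in> ?T \<and> v \<in> S. 1)" by simp
  also have "\<dots> = (\<Sum>S\<in>?T. \<Sum>v | v \<in> verts G \<and> v \<in> S. 1)"
    by (rule sum.swap_restrict[OF finV finT])
  also have "\<dots> = (\<Sum>S\<in>?T. real s)"
  proof (intro sum.cong refl)
    fix S assume "S \<in> ?T"
    then have "{v. v \<in> verts G \<and> v \<in> S} = S" "card S = s" by (auto simp: thin_cliques_def hcliques_def)
    then show "(\<Sum>v | v \<in> verts G \<and> v \<in> S. 1) = real s" by simp
  qed
  also have "\<dots> = real s * real (card ?T)" by simp
  also have "\<dots> \<le> real s * (real m * ?n ^ (s - 1))"
    using card_thin_cliques_le[OF G rs, of m]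
    by (intro mult_left_mono) (simp_all flip: of_nat_power of_nat_mult)
  finally have "(real (card B) * \<beta>) * ?n ^ (s - 1) \<le> (real s * real m) * ?n ^ (s - 1)"
    by (simp add: mult.assoc)
  then have "real (card B) * \<beta> \<le> real s * real m" using n by simp
  then show ?thesis using \<beta> by (simp add: field_simps)
qed

text \<open>The three terms sort the cliques by a thin pair: one containing \<open>v\<close>, one
  with a vertex other than \<open>v\<close> outside \<open>U\<close>, or one inside \<open>U\<close>
  avoiding \<open>v\<close>. In the last case the pair lies in a common edge, hence in two different
  classes, so there are at most \<open>n * t\<close> choices for it.\<close>

lemma card_thin_cliques_at_vertex_le:
  fixes t :: real
  assumes G: "rgraph r G" and rs: "3 \<le> r" "r \<le> s" and v: "v \<in> verts G" and U: "U \<subseteq> verts G"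
    and uncov: "\<And>x y e. x \<in> U \<Longrightarrow> y \<in> U \<Longrightarrow> x \<noteq> y \<Longrightarrow> f x = f y \<Longrightarrow> e \<in> hedges G \<Longrightarrow> \<not> {x, y} \<subseteq> e"
    and miss: "\<And>u. u \<in> U \<Longrightarrow> real (card {w \<in> U. f w \<noteq> f u \<and> \<not> thick m r G u w}) \<le> t" and t: "t \<ge> 0"
  shows "real (card {S \<in> thin_cliques m r s G. v \<in> S})
    \<le> (real m + real (card (verts G - U)) + t) * real (card (verts G)) ^ (s - 2)"
proof -
  let ?n = "card (verts G)" and ?H = "hcliques r s G" and ?B = "verts G - U"
  have finV: "finite (verts G)" using G by (simp add: rgraph_def)
  have finU: "finite U" using U finV finite_subset by blast
  have s2: "s - 2 = Suc (s - 3)" using rs by simp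
  define X1 where "X1 = (\<Union>y\<in>{y \<in> verts G. y \<noteq> v \<and> \<not> thick m r G v y}. {S \<in> ?H. v \<in> S \<and> y \<in> S})"
  define X2 where "X2 = (\<Union>b\<in>?B - {v}. {S. {v, b} \<subseteq> S \<and> S \<subseteq> verts G \<and> card S = s})"
  define X3 where "X3 = (\<Union>x\<in>U - {v}. \<Union>y\<in>{y \<in> U. f y \<noteq> f x \<and> \<not> thick m r G x y} - {v}.
      {S. {v, x, y} \<subseteq> S \<and> S \<subseteq> verts G \<and> card S = s})"
  have "{S \<in> thin_cliques m r s G. v \<in> S} \<subseteq> X1 \<union> (X2 \<union> X3)"
  proof
    fix S assume S: "S \<in> {S \<in> thin_cliques m r s G. v \<in> S}"
    then have SH: "S \<in> ?H" "S \<subseteq> verts G" "card S = s" "v \<in> S" "finite S"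
      using finV by (auto simp: thin_cliques_def hcliques_def dest: finite_subset)
    obtain x y where xy: "x \<in> S" "y \<in> S" "x \<noteq> y" "\<not> thick m r G x y"
      using S by (auto simp: thin_cliques_def pairwise_def)
    consider (1) "x = v \<or> y = v" | (2) "x \<noteq> v" "x \<notin> U" | (3) "y \<noteq> v" "y \<notin> U"
      | (4) "x \<noteq> v" "y \<noteq> v" "x \<in> U" "y \<in> U" by blast
    then show "S \<in> X1 \<union> (X2 \<union> X3)"
    proof cases
      case 1
      then have "S \<in> X1" using xy SH thick_sym[of m r G] unfolding X1_def by blast
      then show ?thesis by simp
    next
      case 2
      then have "S \<in> X2" using xy SH unfolding X2_def by blast
      then show ?thesis by simp
    next
      case 3
      then have "S \<in> X2" using xy SH unfolding X2_def by blast
      then show ?thesis by simp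
    next
      case 4
      obtain e where e: "e \<subseteq> S" "card e = r" "x \<in> e" "y \<in> e"
        using subset_of_card_containing_pair[of S x y r] SH xy rs by auto
      then have "e \<in> hedges G" using SH by (auto simp: hcliques_def)
      then have "f x \<noteq> f y" using uncov[of x y e] 4 xy e by auto
      then have "S \<in> X3" using xy SH 4 unfolding X3_def by (intro UN_I[of x] UN_I[of y]) auto
      then show ?thesis by simp
    qed
  qed
  moreover have "finite (X1 \<union> (X2 \<union> X3))"
    by (rule finite_subset[of _ "Pow (verts G)"])
      (use finV in \<open>auto simp: X1_def X2_def X3_def hcliques_def\<close>)
  ultimately have "card {S \<in> thin_cliques m r s G. v \<in> S} \<le> card (X1 \<union> (X2 \<union> X3))"
    by (intro card_mono)
  also have "\<dots> \<le> card X1 + (card X2 + card X3)"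
    by (intro order_trans[OF card_Un_le] add_left_mono) simp
  finally have "real (card {S \<in> thin_cliques m r s G. v \<in> S}) \<le> real (card X1) + (real (card X2) + real (card X3))"
    by (simp flip: of_nat_add)
  moreover have "real (card X1) \<le> real m * real ?n ^ (s - 2)"
  proof -
    let ?Y = "{y \<in> verts G. y \<noteq> v \<and> \<not> thick m r G v y}"
    have "card X1 \<le> (\<Sum>y\<in>?Y. card {S \<in> ?H. v \<in> S \<and> y \<in> S})"
      unfolding X1_def using finV by (intro card_UN_le) auto
    also have "\<dots> \<le> (\<Sum>y\<in>?Y. m * ?n ^ (s - 3))"
      by (intro sum_mono card_hcliques_thin_pair[OF G rs]) auto
    also have "\<dots> \<le> ?n * (m * ?n ^ (s - 3))"
      using card_mono[OF finV, of ?Y] by (auto intro!: mult_right_mono)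
    also have "\<dots> = m * ?n ^ (s - 2)" unfolding s2 by simp
    finally show ?thesis by (simp flip: of_nat_power of_nat_mult)
  qed
  moreover have "real (card X2) \<le> real (card ?B) * real ?n ^ (s - 2)"
  proof -
    have "card X2 \<le> (\<Sum>b\<in>?B - {v}. card {S. {v, b} \<subseteq> S \<and> S \<subseteq> verts G \<and> card S = s})"
      unfolding X2_def using finV by (intro card_UN_le) auto
    also have "\<dots> \<le> (\<Sum>b\<in>?B - {v}. ?n ^ (s - 2))"
    proof (intro sum_mono)
      fix b assume "b \<in> ?B - {v}"
      moreover from this have "card {v, b} = 2" by auto
      ultimately show "card {S. {v, b} \<subseteq> S \<and> S \<subseteq> verts G \<and> card S = s} \<le> ?n ^ (s - 2)"
        using card_supersets_le[OF finV, of "{v, b}" s] v by auto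
    qed
    also have "\<dots> \<le> card ?B * ?n ^ (s - 2)"
      using card_mono[of ?B "?B - {v}"] finV by (auto intro!: mult_right_mono)
    finally show ?thesis by (simp flip: of_nat_power of_nat_mult)
  qed
  moreover have "real (card X3) \<le> t * real ?n ^ (s - 2)"
  proof -
    let ?M = "\<lambda>x. {y \<in> U. f y \<noteq> f x \<and> \<not> thick m r G x y}"
    let ?F = "\<lambda>x y. {S. {v, x, y} \<subseteq> S \<and> S \<subseteq> verts G \<and> card S = s}"
    have "card X3 \<le> (\<Sum>x\<in>U - {v}. card (\<Union>y\<in>?M x - {v}. ?F x y))"
      unfolding X3_def using finU by (intro card_UN_le) auto
    also have "\<dots> \<le> (\<Sum>x\<in>U - {v}. \<Sum>y\<in>?M x - {v}. card (?F x y))"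
      using finU by (intro sum_mono card_UN_le) auto
    also have "\<dots> \<le> (\<Sum>x\<in>U - {v}. \<Sum>y\<in>?M x - {v}. ?n ^ (s - 3))"
    proof (intro sum_mono)
      fix x y assume xy: "x \<in> U - {v}" "y \<in> ?M x - {v}"
      then have "x \<noteq> y" "v \<noteq> x" "v \<noteq> y" by auto
      then have "card {v, x, y} = 3" by simp
      then show "card (?F x y) \<le> ?n ^ (s - 3)"
        using card_supersets_le[OF finV, of "{v, x, y}" s] v U xy by auto
    qed
    finally have "real (card X3) \<le> real (\<Sum>x\<in>U - {v}. \<Sum>y\<in>?M x - {v}. ?n ^ (s - 3))"
      by (simp only: of_nat_le_iff)
    also have "\<dots> = (\<Sum>x\<in>U - {v}. real (card (?M x - {v})) * real ?n ^ (s - 3))" by simp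
    also have "\<dots> \<le> (\<Sum>x\<in>U - {v}. t * real ?n ^ (s - 3))"
    proof (intro sum_mono mult_right_mono)
      fix x assume "x \<in> U - {v}"
      moreover have "card (?M x - {v}) \<le> card (?M x)" using finU by (intro card_mono) auto
      ultimately show "real (card (?M x - {v})) \<le> t" using miss[of x] by simp
    qed simp
    also have "\<dots> \<le> real ?n * (t * real ?n ^ (s - 3))"
    proof -
      have "card (U - {v}) \<le> ?n" using finV U by (intro card_mono) auto
      then show ?thesis using t by (auto intro!: mult_right_mono)
    qed
    also have "\<dots> = t * real ?n ^ (s - 2)" unfolding s2 by simp
    finally show ?thesis .
  qed
  ultimately show ?thesis by (simp add: algebra_simps)
qed

section \<open>Large minimum clique degree forces \<open>l\<close> parts\<close>

text \<open>Inverts Zykov's bound at a vertex: \<open>d\<close> stands for the thick degree and the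
  \<open>\<beta>\<close> term for the thin cliques there. The constants depend only on
  \<open>l\<close>, \<open>k\<close> and \<open>\<alpha>\<close>.\<close>

lemma degree_from_clique_count:
  fixes \<alpha> C :: real
  assumes l: "2 \<le> l" and k: "1 \<le> k" and C: "1 \<le> C" and \<alpha>: "0 < \<alpha>" "\<alpha> < 1 / real l"
  obtains \<beta> :: real and n0 :: nat where "\<beta> > 0"
    "\<And>n d. n0 \<le> n \<Longrightarrow> 0 \<le> d \<Longrightarrow>
      C * real ((n - 1) div l) ^ k \<le> C * (d / real (l - 1)) ^ k + \<beta> * real n ^ k \<Longrightarrow>
      (1 - 1 / real l - \<alpha>) * real n \<le> d"
proof -
  \<comment> \<open>The value of \<open>d / ((l - 1) * n)\<close> at the claimed bound is
    \<open>b\<close>, and \<open>a\<close> lies halfway between \<open>b\<close> and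
    \<open>1 / l\<close>. Rounding in \<open>(n - 1) div l\<close> costs at most 1, which
    \<open>\<gamma> / 2 * n\<close> absorbs once \<open>n \<ge> 2 / \<gamma>\<close>. Half the gap
    of the powers is left for \<open>\<beta>\<close>.\<close>
  define \<gamma> where "\<gamma> = \<alpha> / real (l - 1)"
  define a where "a = 1 / real l - \<gamma> / 2"
  define b where "b = 1 / real l - \<gamma>"
  define \<beta> where "\<beta> = (a ^ k - b ^ k) / 2"
  have l1: "real (l - 1) \<ge> 1" and l2: "real (l - 1) = real l - 1" using l by (auto simp: of_nat_diff)
  have \<gamma>: "\<gamma> > 0" using \<alpha> l1 by (simp add: \<gamma>_def)
  have "\<gamma> \<le> \<alpha>" using \<alpha> l1 by (simp add: \<gamma>_def field_simps)
  then have b: "b > 0" using \<alpha> by (simp add: b_def)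
  have ab: "a > b" using \<gamma> by (simp add: a_def b_def)
  have \<beta>: "\<beta> > 0" using power_strict_mono[OF ab, of k] b k by (simp add: \<beta>_def)
  have eq: "1 - 1 / real l - \<alpha> = real (l - 1) * b"
    using l1 l by (simp add: b_def \<gamma>_def right_diff_distrib l2 field_simps)
  show thesis
  proof (rule that[OF \<beta>])
    fix n :: nat and d :: real
    assume n: "nat \<lceil>2 / \<gamma>\<rceil> + 1 \<le> n" and d: "0 \<le> d"
      and h: "C * real ((n - 1) div l) ^ k \<le> C * (d / real (l - 1)) ^ k + \<beta> * real n ^ k"
    have n0: "real n > 0" and n\<gamma>: "real n \<ge> 2 / \<gamma>" using n by linarith+
    show "(1 - 1 / real l - \<alpha>) * real n \<le> d"
    proof (rule ccontr)
      assume "\<not> ?thesis"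
      then have "d < real (l - 1) * (b * real n)" by (simp add: eq mult.assoc)
      then have "d / real (l - 1) < b * real n" using l1 by (simp add: field_simps)
      then have "(d / real (l - 1)) ^ k \<le> (b * real n) ^ k" using d l1 by (intro power_mono) auto
      then have 1: "(d / real (l - 1)) ^ k \<le> b ^ k * real n ^ k" by (simp add: power_mult_distrib)
      have "n - 1 = ((n - 1) div l) * l + (n - 1) mod l" by simp
      moreover have "(n - 1) mod l < l" using l by simp
      ultimately have "n \<le> ((n - 1) div l) * l + l" by linarith
      then have "real n \<le> real ((n - 1) div l) * real l + real l"
        by (simp flip: of_nat_mult of_nat_add)
      then have "real ((n - 1) div l) \<ge> real n / real l - 1" using l by (simp add: field_simps)
      moreover have "\<gamma> / 2 * real n \<ge> 1" using n\<gamma> \<gamma> by (simp add: field_simps)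
      ultimately have "real ((n - 1) div l) \<ge> a * real n" by (simp add: a_def algebra_simps)
      then have "(a * real n) ^ k \<le> real ((n - 1) div l) ^ k" using ab b by (intro power_mono) auto
      then have "C * (a ^ k * real n ^ k) \<le> C * real ((n - 1) div l) ^ k"
        using C by (intro mult_left_mono) (auto simp: power_mult_distrib)
      also have "\<dots> \<le> C * (b ^ k * real n ^ k) + \<beta> * real n ^ k"
        using h mult_left_mono[OF 1, of C] C by linarith
      finally have "(C * (a ^ k - b ^ k)) * real n ^ k \<le> \<beta> * real n ^ k" by (simp add: algebra_simps)
      then have "C * (a ^ k - b ^ k) \<le> \<beta>" by (rule mult_right_le_imp_le) (use n0 in simp)
      moreover have "a ^ k - b ^ k = 2 * \<beta>" by (simp add: \<beta>_def)
      ultimately have "C * (2 * \<beta>) \<le> \<beta>" by simp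
      moreover have "1 * (2 * \<beta>) \<le> C * (2 * \<beta>)" using C \<beta> by (intro mult_right_mono) auto
      ultimately show False using \<beta> by linarith
    qed
  qed
qed

text \<open>The thick neighbourhood of \<open>v\<close> has no thick \<open>l\<close>-clique, since
  \<open>v\<close> would extend it. Zykov's bound with \<open>l - 1\<close> in place of
  \<open>l\<close> therefore covers the cliques all of whose pairs are thick; the others are
  thin.\<close>

lemma card_hcliques_at_vertex_le:
  fixes G :: "'a hypergraph" and r l :: nat
  defines "D \<equiv> thick (expansion_bound r l) r G"
  assumes G: "rgraph r G" and free: "hg_free (expansion r (complete_rgraph 2 (Suc l))) G"
    and s: "1 \<le> s" and l: "1 \<le> l" and v: "v \<in> verts G"
  shows "real (card {S \<in> hcliques r s G. v \<in> S})
    \<le> real ((l - 1) choose (s - 1)) * (real (card {w \<in> verts G. D v w}) / real (l - 1)) ^ (s - 1)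
      + real (card {S \<in> thin_cliques (expansion_bound r l) r s G. v \<in> S})"
proof -
  let ?T = "thin_cliques (expansion_bound r l) r s G"
  have finV: "finite (verts G)" using G by (simp add: rgraph_def)
  have sym: "\<And>u v. D u v \<Longrightarrow> D v u" and irr: "\<And>u. \<not> D u u"
    by (auto simp: D_def thick_irrefl intro: thick_sym)
  have contain: "card {S \<in> kcliques D (verts G) (Suc k). v \<in> S} = card (kcliques D {w \<in> verts G. D v w} k)" for k
    by (rule card_kcliques_containing[OF finV v sym irr])
  have "card {S \<in> hcliques r s G. v \<in> S}
      \<le> card ({S \<in> kcliques D (verts G) (Suc (s - 1)). v \<in> S} \<union> {S \<in> ?T. v \<in> S})"
    using finV s finite_thin_cliques[OF G]
    by (intro card_mono) (auto simp: finite_kcliques thin_cliques_def kcliques_def hcliques_def D_def)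
  also have "\<dots> \<le> card (kcliques D {w \<in> verts G. D v w} (s - 1)) + card {S \<in> ?T. v \<in> S}"
    unfolding contain[symmetric] by (rule card_Un_le)
  finally have 1: "real (card {S \<in> hcliques r s G. v \<in> S})
      \<le> real (card (kcliques D {w \<in> verts G. D v w} (s - 1))) + real (card {S \<in> ?T. v \<in> S})"
    by (simp flip: of_nat_add)
  have "kcliques D (verts G) (Suc l) = {}"
    unfolding D_def by (rule no_thick_cliques[OF G free l])
  then have "card (kcliques D {w \<in> verts G. D v w} l) = 0" using contain[of l] by simp
  moreover have "finite (kcliques D {w \<in> verts G. D v w} l)" using finV by (intro finite_kcliques) simp
  ultimately have "kcliques D {w \<in> verts G. D v w} (Suc (l - 1)) = {}" using l by simp
  then show ?thesis
    using 1 card_kcliques_le[of D "{w \<in> verts G. D v w}" "l - 1" "s - 1", OF sym irr] finV by simp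
qed

text \<open>Combines \<open>near_turan_partition\<close> with \<open>same_class_uncovered\<close>.
  It is stated for a subset \<open>U\<close> so that it serves both rounds of the final
  argument.\<close>

lemma uncovered_partition:
  fixes \<alpha> :: real and G :: "'a hypergraph" and r l :: nat
  defines "D \<equiv> thick (expansion_bound r l) r G"
  assumes G: "rgraph r G" and free: "hg_free (expansion r (complete_rgraph 2 (Suc l))) G" and l: "1 \<le> l"
    and U: "U \<subseteq> verts G" and N: "real (card U) > 2 * real l * real r" and \<alpha>: "\<alpha> > 0" "\<alpha> * (8 * real l ^ 4) \<le> 1"
    and deg: "\<And>u. u \<in> U \<Longrightarrow> real (card {w \<in> U. D u w}) \<ge> (1 - 1 / real l - \<alpha>) * real (card U)"
  shows "\<exists>f. f ` U \<subseteq> {..<l}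
    \<and> (\<forall>u\<in>U. real (card {w \<in> U. f w \<noteq> f u \<and> \<not> D u w}) \<le> real l ^ 2 * \<alpha> * real (card U))
    \<and> (\<forall>x\<in>U. \<forall>y\<in>U. \<forall>e\<in>hedges G. x \<noteq> y \<longrightarrow> f x = f y \<longrightarrow> \<not> {x, y} \<subseteq> e)"
proof -
  have finV: "finite (verts G)" using G by (simp add: rgraph_def)
  have finU: "finite U" using U finV finite_subset by blast
  have N0: "real (card U) > 0" using N by (meson le_less_trans mult_nonneg_nonneg of_nat_0_le_iff zero_le_numeral)
  have sym: "\<And>u v. D u v \<Longrightarrow> D v u" and irr: "\<And>u. \<not> D u u"
    by (auto simp: D_def thick_irrefl intro: thick_sym)
  have "kcliques D (verts G) (Suc l) = {}"
    unfolding D_def by (rule no_thick_cliques[OF G free l])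
  then have kfree: "kcliques D U (Suc l) = {}" using U by (auto simp: kcliques_def)
  have l1: "real l \<ge> 1" using l by simp
  then have lpow: "real l \<le> real l ^ 3" "real l ^ 2 \<le> real l ^ 3" "real l ^ 3 \<le> real l ^ 4"
    using power_increasing[of 1 3 "real l"] by (simp_all add: power_increasing)
  have "\<alpha> * (4 * real l ^ 3) \<le> \<alpha> * (8 * real l ^ 4)"
    using \<alpha> lpow l1 by (intro mult_left_mono) linarith+
  then have \<alpha>3: "\<alpha> * (4 * real l ^ 3) \<le> 1" using \<alpha> by linarith
  have Une: "U \<noteq> {}" using N0 by auto
  obtain f where f: "f ` U \<subseteq> {..<l}"
    and miss: "\<forall>u\<in>U. real (card {w \<in> U. f w \<noteq> f u \<and> \<not> D u w}) \<le> real l ^ 2 * \<alpha> * real (card U)"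
    and size: "\<forall>i<l. real (card {u \<in> U. f u = i}) \<ge> (1 / real l - real l * \<alpha>) * real (card U)"
    using near_turan_partition[of D U l \<alpha>, OF sym irr finU Une kfree l deg \<alpha>(1) \<alpha>3] by blast
  show ?thesis
  proof (intro exI conjI f miss ballI impI)
    fix x y e assume xy: "x \<in> U" "y \<in> U" "x \<noteq> y" "f x = f y" and e: "e \<in> hedges G"
    show "\<not> {x, y} \<subseteq> e"
    proof (rule same_class_uncovered[OF G free U f, of "real l ^ 2 * \<alpha> * real (card U)"])
      show "0 \<le> real l ^ 2 * \<alpha> * real (card U)" using \<alpha> by simp
    next
      fix i assume i: "i < l"
      \<comment> \<open>Of the ideal class size \<open>card U / l\<close>, one half pays for the
        deviation of the class and all missing pairs, which is where \<open>8 * real l ^ 4\<close>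
        comes from; the other half exceeds \<open>r\<close> because
        \<open>card U > 2 * l * r\<close>.\<close>
      have "(real l + (real l + 2) * real l ^ 2) * \<alpha> \<le> (4 * real l ^ 3) * \<alpha>"
        using \<alpha> lpow by (intro mult_right_mono) (auto simp: algebra_simps power2_eq_square power3_eq_cube)
      also have "\<dots> \<le> 1 / (2 * real l)" using \<alpha> l1 by (simp add: field_simps power_eq_if)
      finally have "(real l + (real l + 2) * real l ^ 2) * \<alpha> * real (card U) \<le> 1 / (2 * real l) * real (card U)"
        using N0 by (intro mult_right_mono) auto
      moreover have "real r < 1 / (2 * real l) * real (card U)" using N l1 by (simp add: field_simps)
      moreover have "1 / real l * real (card U) = 1 / (2 * real l) * real (card U) + 1 / (2 * real l) * real (card U)"
        using l1 by (simp add: field_simps)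
      ultimately have "(real l + 2) * (real l ^ 2 * \<alpha> * real (card U)) + real r
          < (1 / real l - real l * \<alpha>) * real (card U)"
        by (simp add: algebra_simps)
      then show "(real l + 2) * (real l ^ 2 * \<alpha> * real (card U)) + real r < real (card {u \<in> U. f u = i})"
        using size i by fastforce
    qed (use miss xy e in \<open>auto simp: D_def\<close>)
  qed (use f miss in auto)
qed

text \<open>Thin pairs spoil only boundedly many vertices a priori. Partitioning the other vertices
  shows that thin pairs are rare at every vertex, and a second partition then covers all vertices.\<close>

lemma l_partite_of_min_clique_degree:
  fixes l s r :: nat
  assumes ls: "s \<le> l" and rs: "r \<le> s" and r: "3 \<le> r"
  obtains n1 :: nat where
    "\<And>G :: 'a hypergraph. rgraph r G \<Longrightarrow> n1 \<le> card (verts G) \<Longrightarrow>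
      hg_free (expansion r (complete_rgraph 2 (Suc l))) G \<Longrightarrow>
      (\<And>v. v \<in> verts G \<Longrightarrow>
        ((l - 1) choose (s - 1)) * ((card (verts G) - 1) div l) ^ (s - 1) \<le> card {S \<in> hcliques r s G. v \<in> S}) \<Longrightarrow>
      \<exists>f. f ` verts G \<subseteq> {..<l} \<and> (\<forall>e\<in>hedges G. inj_on f e)"
proof -
  define m where "m = expansion_bound r l"
  define C where "C = real ((l - 1) choose (s - 1))"
  \<comment> \<open>The largest value that \<open>uncovered_partition\<close> admits. The constants
    are fixed backwards: \<open>\<alpha>2\<close> determines \<open>\<beta>2\<close> for the second
    round, which determines \<open>\<alpha>1\<close> and then \<open>\<beta>1\<close> for the
    first.\<close>
  define \<alpha>2 where "\<alpha>2 = 1 / (8 * real l ^ 4)"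
  have l3: "real l \<ge> 3" using assms by simp
  have l4: "real l ^ 4 \<ge> real l" using power_increasing[of 1 4 "real l"] l3 by simp
  then have l8: "real l < 8 * real l ^ 4" "24 \<le> 8 * real l ^ 4" using l3 by linarith+
  have \<alpha>2: "\<alpha>2 > 0" "\<alpha>2 < 1 / real l" "\<alpha>2 \<le> 1 / 24" "\<alpha>2 * (8 * real l ^ 4) \<le> 1"
    unfolding \<alpha>2_def using l3 frac_less2[OF _ _ _ l8(1), of 1 1] frac_le[OF _ _ _ l8(2), of 1 1] by auto
  have "C \<ge> 1" using assms by (simp add: C_def Suc_leI)
  have l1: "1 \<le> l" and l2: "2 \<le> l" and k1: "1 \<le> s - 1" using assms by auto
  obtain \<beta>2 n2 where \<beta>2: "\<beta>2 > 0" and deg2: "\<And>n d. n2 \<le> n \<Longrightarrow> 0 \<le> d \<Longrightarrow>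
      C * real ((n - 1) div l) ^ (s - 1) \<le> C * (d / real (l - 1)) ^ (s - 1) + \<beta>2 * real n ^ (s - 1) \<Longrightarrow>
      (1 - 1 / real l - \<alpha>2) * real n \<le> d"
    using degree_from_clique_count[OF l2 k1 \<open>C \<ge> 1\<close> \<alpha>2(1,2)] by blast
  \<comment> \<open>The second bound keeps the missing pairs of the first partition, at most
    \<open>l ^ 2 * \<alpha>1 * n\<close> per vertex, below half of the thin contribution
    \<open>\<beta>2\<close> allowed in the second round.\<close>
  define \<alpha>1 where "\<alpha>1 = min \<alpha>2 (\<beta>2 / (2 * real l ^ 2))"
  have \<alpha>1: "\<alpha>1 > 0" "\<alpha>1 \<le> \<alpha>2" "real l ^ 2 * \<alpha>1 \<le> \<beta>2 / 2"
  proof -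
    show "\<alpha>1 > 0" "\<alpha>1 \<le> \<alpha>2" using \<alpha>2 \<beta>2 l3 by (auto simp: \<alpha>1_def)
    have "\<alpha>1 \<le> \<beta>2 / (2 * real l ^ 2)" by (simp add: \<alpha>1_def)
    then show "real l ^ 2 * \<alpha>1 \<le> \<beta>2 / 2" using l3 by (simp add: field_simps)
  qed
  \<comment> \<open>Degrees are first obtained in the whole hypergraph. The other half of
    \<open>\<alpha>1\<close> pays for passing to \<open>U\<close>.\<close>
  have \<alpha>1': "\<alpha>1 / 2 > 0" "\<alpha>1 / 2 < 1 / real l" using \<alpha>1 \<alpha>2 by auto
  obtain \<beta>1 n1 where \<beta>1: "\<beta>1 > 0" and deg1: "\<And>n d. n1 \<le> n \<Longrightarrow> 0 \<le> d \<Longrightarrow>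
      C * real ((n - 1) div l) ^ (s - 1) \<le> C * (d / real (l - 1)) ^ (s - 1) + \<beta>1 * real n ^ (s - 1) \<Longrightarrow>
      (1 - 1 / real l - \<alpha>1 / 2) * real n \<le> d"
    using degree_from_clique_count[OF l2 k1 \<open>C \<ge> 1\<close> \<alpha>1'] by blast
  \<comment> \<open>Here \<open>b\<close> bounds the exceptional set \<open>B\<close>. Beyond
    \<open>c1\<close> this set is at most \<open>\<alpha>1 / 2 * n\<close>, beyond \<open>c2\<close>
    the sum \<open>m + card B\<close> is at most \<open>\<beta>2 / 2 * n\<close>, and
    \<open>4 * (l * r)\<close> ensures \<open>card U \<ge> n / 2 > 2 * l * r\<close>.\<close>
  define b where "b = real s * real m / \<beta>1"
  define c1 where "c1 = nat \<lceil>2 * b / \<alpha>1\<rceil>"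
  define c2 where "c2 = nat \<lceil>2 * (real m + b) / \<beta>2\<rceil>"
  define n3 where "n3 = c1 + c2 + 4 * (l * r) + 1"
  show thesis
  proof (rule that[of "max n1 (max n2 n3)"])
    fix G :: "'a hypergraph"
    assume G: "rgraph r G" and n_ge: "max n1 (max n2 n3) \<le> card (verts G)"
      and free: "hg_free (expansion r (complete_rgraph 2 (Suc l))) G"
      and mindeg: "\<And>v. v \<in> verts G \<Longrightarrow>
        ((l - 1) choose (s - 1)) * ((card (verts G) - 1) div l) ^ (s - 1) \<le> card {S \<in> hcliques r s G. v \<in> S}"
    define n where "n = card (verts G)"
    define D where "D = thick m r G"
    define bad where "bad v = real (card {S \<in> thin_cliques m r s G. v \<in> S})" for v
    have finV: "finite (verts G)" using G by (simp add: rgraph_def)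
    have nn: "n1 \<le> n" "n2 \<le> n" "n3 \<le> n" using n_ge by (auto simp: n_def)
    have "c1 \<le> n" "c2 \<le> n" "4 * (l * r) < n"
      using nn(3) by (simp_all add: n3_def)
    then have n0: "real n > 0" and nb: "2 * b / \<alpha>1 \<le> real n" and nm: "2 * (real m + b) / \<beta>2 \<le> real n"
      and nr': "4 * (real l * real r) < real n"
      unfolding c1_def c2_def nat_ceiling_le_eq by (simp_all flip: of_nat_mult)
    have key: "C * real ((n - 1) div l) ^ (s - 1)
        \<le> C * (real (card {w \<in> verts G. D v w}) / real (l - 1)) ^ (s - 1) + bad v" if v: "v \<in> verts G" for v
    proof -
      have "C * real ((n - 1) div l) ^ (s - 1) \<le> real (card {S \<in> hcliques r s G. v \<in> S})"
        using mindeg[OF v] unfolding C_def n_def by (simp flip: of_nat_power of_nat_mult)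
      also have "\<dots> \<le> C * (real (card {w \<in> verts G. D v w}) / real (l - 1)) ^ (s - 1) + bad v"
        unfolding C_def bad_def D_def m_def
        using card_hcliques_at_vertex_le[OF G free _ _ v, of s] l2 k1 by simp
      finally show ?thesis .
    qed
    define B where "B = {v \<in> verts G. bad v > \<beta>1 * real n ^ (s - 1)}"
    have Bb: "real (card B) \<le> b"
      unfolding B_def bad_def n_def b_def by (rule card_thin_exceptional_le[OF G r rs \<beta>1])
    define U where "U = verts G - B"
    have U: "U \<subseteq> verts G" and VU: "verts G - U = B" by (auto simp: U_def B_def)
    have cU: "real (card U) = real n - real (card B)"
      unfolding U_def n_def using finV card_mono[OF finV, of B]
      by (subst card_Diff_subset) (auto simp: B_def of_nat_diff)
    have B\<alpha>: "real (card B) \<le> \<alpha>1 / 2 * real n"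
      using Bb nb \<alpha>1(1) by (simp add: field_simps)
    moreover have "\<alpha>1 / 2 * real n \<le> 1 / 2 * real n" using \<alpha>1 \<alpha>2 n0 by (intro mult_right_mono) auto
    ultimately have cU2: "real (card U) \<ge> real n / 2" using cU by simp
    have cUn: "real (card U) \<le> real n" using cU by simp
    have \<alpha>1'': "\<alpha>1 * (8 * real l ^ 4) \<le> 1"
      using mult_right_mono[OF \<alpha>1(2), of "8 * real l ^ 4"] \<alpha>2(4) by simp
    have degU: "(1 - 1 / real l - \<alpha>1) * real (card U) \<le> real (card {w \<in> U. D u w})" if u: "u \<in> U" for u
    proof -
      have "u \<in> verts G" "bad u \<le> \<beta>1 * real n ^ (s - 1)" using u by (auto simp: U_def B_def)
      then have "(1 - 1 / real l - \<alpha>1 / 2) * real n \<le> real (card {w \<in> verts G. D u w})"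
        using key[of u] by (intro deg1[OF nn(1)]) auto
      moreover have "card {w \<in> verts G. D u w} \<le> card ({w \<in> U. D u w} \<union> B)"
        using finV by (intro card_mono) (auto simp: U_def B_def)
      then have "real (card {w \<in> verts G. D u w}) \<le> real (card {w \<in> U. D u w}) + real (card B)"
        using card_Un_le[of "{w \<in> U. D u w}" B] by linarith
      ultimately have "(1 - 1 / real l - \<alpha>1) * real n \<le> real (card {w \<in> U. D u w})"
        using B\<alpha> by (simp add: algebra_simps)
      moreover have "1 / real l \<le> 1 / 3" using l3 by (simp add: field_simps)
      then have "(1 - 1 / real l - \<alpha>1) * real (card U) \<le> (1 - 1 / real l - \<alpha>1) * real n"
        using cUn \<alpha>1 \<alpha>2 by (intro mult_left_mono) linarith+
      ultimately show ?thesis by linarith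
    qed
    have NU: "real (card U) > 2 * real l * real r" using cU2 nr' by simp
    obtain f1 where f1: "f1 ` U \<subseteq> {..<l}"
      and miss1: "\<forall>u\<in>U. real (card {w \<in> U. f1 w \<noteq> f1 u \<and> \<not> D u w}) \<le> real l ^ 2 * \<alpha>1 * real (card U)"
      and uncov1: "\<forall>x\<in>U. \<forall>y\<in>U. \<forall>e\<in>hedges G. x \<noteq> y \<longrightarrow> f1 x = f1 y \<longrightarrow> \<not> {x, y} \<subseteq> e"
      using uncovered_partition[OF G free l1 U NU \<alpha>1(1) \<alpha>1'' degU[unfolded D_def m_def],
          folded m_def, folded D_def] by blast
    have bad2: "bad v \<le> \<beta>2 * real n ^ (s - 1)" if v: "v \<in> verts G" for v
    proof -
      have "bad v \<le> (real m + real (card B) + real l ^ 2 * \<alpha>1 * real (card U)) * real n ^ (s - 2)"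
        unfolding bad_def n_def VU[symmetric]
      proof (rule card_thin_cliques_at_vertex_le[OF G r rs v U])
        show "\<And>x y e. x \<in> U \<Longrightarrow> y \<in> U \<Longrightarrow> x \<noteq> y \<Longrightarrow> f1 x = f1 y \<Longrightarrow> e \<in> hedges G \<Longrightarrow> \<not> {x, y} \<subseteq> e"
          using uncov1 by blast
        show "\<And>u. u \<in> U \<Longrightarrow> real (card {w \<in> U. f1 w \<noteq> f1 u \<and> \<not> thick m r G u w}) \<le> real l ^ 2 * \<alpha>1 * real (card U)"
          using miss1 unfolding D_def by blast
        show "0 \<le> real l ^ 2 * \<alpha>1 * real (card U)" using \<alpha>1(1) by simp
      qed
      also have "\<dots> \<le> (\<beta>2 * real n) * real n ^ (s - 2)"
      proof (intro mult_right_mono)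
        have "real l ^ 2 * \<alpha>1 * real (card U) \<le> \<beta>2 / 2 * real n"
          using \<alpha>1 cUn \<beta>2 by (intro mult_mono) auto
        moreover have "real m + real (card B) \<le> \<beta>2 / 2 * real n"
          using nm Bb \<beta>2 by (simp add: field_simps)
        ultimately show "real m + real (card B) + real l ^ 2 * \<alpha>1 * real (card U) \<le> \<beta>2 * real n"
          by (simp add: algebra_simps)
      qed simp
      also have "\<dots> = \<beta>2 * real n ^ (s - 1)"
      proof -
        have "s - 1 = Suc (s - 2)" using r rs by simp
        then show ?thesis by simp
      qed
      finally show ?thesis .
    qed
    have degV: "(1 - 1 / real l - \<alpha>2) * real (card (verts G)) \<le> real (card {w \<in> verts G. D u w})" if u: "u \<in> verts G" for u
      unfolding n_def[symmetric] using key[OF u] bad2[OF u] by (intro deg2[OF nn(2)]) auto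
    have NV: "real (card (verts G)) > 2 * real l * real r" using nr' n0 by (simp add: n_def[symmetric])
    obtain f where f: "f ` verts G \<subseteq> {..<l}"
      and uncov: "\<forall>x\<in>verts G. \<forall>y\<in>verts G. \<forall>e\<in>hedges G. x \<noteq> y \<longrightarrow> f x = f y \<longrightarrow> \<not> {x, y} \<subseteq> e"
      using uncovered_partition[OF G free l1 subset_refl NV \<alpha>2(1,4) degV[unfolded D_def m_def]] by blast
    have "inj_on f e" if e: "e \<in> hedges G" for e
    proof (rule inj_onI)
      fix x y assume "x \<in> e" "y \<in> e" "f x = f y"
      moreover have "e \<subseteq> verts G" using e G by (simp add: rgraph_def)
      ultimately show "x = y" using uncov e by blast
    qed
    then show "\<exists>f. f ` verts G \<subseteq> {..<l} \<and> (\<forall>e\<in>hedges G. inj_on f e)" using f by blast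
  qed
qed

section \<open>Comparison with the Turan hypergraph\<close>

lemma hcliques_turan_rgraph:
  assumes l: "l > 0" and rs: "2 \<le> r" "r \<le> s"
  shows "hcliques r s (turan_rgraph r n l) = transversals (\<lambda>v. v mod l) {..<n} s"
proof (intro equalityI subsetI)
  fix S assume S: "S \<in> hcliques r s (turan_rgraph r n l)"
  then have SV: "S \<subseteq> {..<n}" "card S = s" "finite S"
    by (auto simp: hcliques_def turan_rgraph_def dest: finite_subset)
  have "inj_on (\<lambda>v. v mod l) S"
  proof (rule inj_onI, rule ccontr)
    fix x y assume xy: "x \<in> S" "y \<in> S" "x mod l = y mod l" "x \<noteq> y"
    then obtain e where e: "e \<subseteq> S" "card e = r" "x \<in> e" "y \<in> e"
      using subset_of_card_containing_pair[of S x y r] SV rs by auto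
    then have "e \<in> hedges (turan_rgraph r n l)" using S by (auto simp: hcliques_def)
    then have "card (e \<inter> turan_part n l (x mod l)) \<le> 1" using l by (simp add: turan_rgraph_def)
    moreover have "card {x, y} \<le> card (e \<inter> turan_part n l (x mod l))"
      using e xy SV by (intro card_mono) (auto simp: turan_part_def dest: finite_subset)
    ultimately show False using xy by simp
  qed
  then show "S \<in> transversals (\<lambda>v. v mod l) {..<n} s" using SV by (simp add: transversals_def)
next
  fix S assume S: "S \<in> transversals (\<lambda>v. v mod l) {..<n} s"
  have "card (e \<inter> turan_part n l i) \<le> 1" if "e \<subseteq> S" for e i
  proof -
    have "finite (e \<inter> turan_part n l i)" by (simp add: turan_part_def)
    moreover have "\<forall>x\<in>e \<inter> turan_part n l i. \<forall>y\<in>e \<inter> turan_part n l i. x = y"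
      using S that by (auto simp: transversals_def turan_part_def inj_on_def)
    ultimately show ?thesis using card_le_Suc0_iff_eq by auto
  qed
  then show "S \<in> hcliques r s (turan_rgraph r n l)"
    using S by (auto simp: hcliques_def turan_rgraph_def transversals_def)
qed

text \<open>By pigeonhole two of the \<open>Suc l\<close> core vertices fall into one part, yet the
  expansion has an edge through both.\<close>

lemma hg_free_turan_rgraph:
  assumes l: "l > 0"
  shows "hg_free (expansion r (complete_rgraph 2 (Suc l))) (turan_rgraph r n l)"
proof (rule ccontr)
  let ?F = "expansion r (complete_rgraph 2 (Suc l))" and ?T = "turan_rgraph r n l"
  assume "\<not> hg_free ?F ?T"
  then obtain H f where H: "subhypergraph H ?T" and f: "bij_betw f (verts ?F) (verts H)"
    and fe: "(\<lambda>e. f ` e) ` hedges ?F = hedges H"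
    by (auto simp: hg_free_def copies_def hg_iso_def)
  have "\<not> inj_on (\<lambda>i. f (Inl i) mod l) {..<Suc l}"
  proof (rule pigeonhole)
    have "(\<lambda>i. f (Inl i) mod l) ` {..<Suc l} \<subseteq> {..<l}" using l by auto
    then have "card ((\<lambda>i. f (Inl i) mod l) ` {..<Suc l}) \<le> card {..<l}" by (intro card_mono) auto
    then show "card ((\<lambda>i. f (Inl i) mod l) ` {..<Suc l}) < card {..<Suc l}" by simp
  qed
  then obtain i j where ij: "i < Suc l" "j < Suc l" "i \<noteq> j" "f (Inl i) mod l = f (Inl j) mod l"
    by (auto simp: inj_on_def)
  define d where "d = Inl ` {i, j} \<union> Inr ` ({{i, j}} \<times> {..<r - 2})"
  have "{i, j} \<in> hedges (complete_rgraph 2 (Suc l))" using ij by (auto simp: complete_rgraph_def)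
  then have "d \<in> hedges ?F" unfolding d_def expansion_def hypergraph.sel by (rule image_eqI[OF refl])
  then have "f ` d \<in> hedges ?T" using fe H by (auto simp: subhypergraph_def)
  then have e: "f ` d \<subseteq> {..<n}" "card (f ` d \<inter> turan_part n l (f (Inl i) mod l)) \<le> 1"
    using l by (auto simp: turan_rgraph_def)
  have "f (Inl i) \<noteq> f (Inl j)"
  proof
    assume "f (Inl i) = f (Inl j)"
    moreover have "Inl i \<in> verts ?F" "Inl j \<in> verts ?F" using ij by (auto simp: expansion_def complete_rgraph_def)
    ultimately show False using f ij by (auto simp: bij_betw_def dest: inj_onD)
  qed
  moreover have "card {f (Inl i), f (Inl j)} \<le> card (f ` d \<inter> turan_part n l (f (Inl i) mod l))"
  proof (rule card_mono)
    show "finite (f ` d \<inter> turan_part n l (f (Inl i) mod l))" by (simp add: turan_part_def)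
    have "f (Inl i) \<in> f ` d" "f (Inl j) \<in> f ` d" by (auto simp: d_def)
    then show "{f (Inl i), f (Inl j)} \<subseteq> f ` d \<inter> turan_part n l (f (Inl i) mod l)"
      using e(1) ij(4) by (auto simp: turan_part_def)
  qed
  ultimately show False using e(2) by simp
qed

lemma sum_card_fibres:
  assumes "finite V" "finite I" "f ` V \<subseteq> I"
  shows "(\<Sum>i\<in>I. card {v \<in> V. f v = i}) = card V"
proof -
  have "V = (\<Union>i\<in>I. {v \<in> V. f v = i})" using assms by auto
  moreover have "card (\<Union>i\<in>I. {v \<in> V. f v = i}) = (\<Sum>i\<in>I. card {v \<in> V. f v = i})"
    using assms by (intro card_UN_disjoint) auto
  ultimately show ?thesis by simp
qed

lemma card_hcliques_turan_rgraph:
  assumes "l > 0" "2 \<le> r" "r \<le> s"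
  shows "card (hcliques r s (turan_rgraph r n l)) = esym {..<l} (\<lambda>i. card (turan_part n l i)) s"
proof -
  have "card (transversals (\<lambda>v. v mod l) {..<n} s)
      = esym {..<l} (\<lambda>i. card {v \<in> {..<n}. v mod l = i}) s"
    using assms(1) by (intro card_transversals) auto
  then show ?thesis unfolding hcliques_turan_rgraph[OF assms] turan_part_def by simp
qed

text \<open>The new vertex \<open>n\<close> joins the part \<open>n mod l\<close>, and its cliques
  are the transversals of size \<open>s - 1\<close> of the other \<open>l - 1\<close> parts, each of
  size at least \<open>n div l\<close>. This is the gain against which the deleted vertex is
  compared.\<close>

lemma card_hcliques_turan_rgraph_Suc:
  assumes l: "l > 0" and rs: "2 \<le> r" "r \<le> s"
  shows "card (hcliques r s (turan_rgraph r n l)) + ((l - 1) choose (s - 1)) * (n div l) ^ (s - 1)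
    \<le> card (hcliques r s (turan_rgraph r (Suc n) l))"
proof -
  define i where "i = n mod l"
  define I where "I = {..<l} - {i}"
  define a where "a n j = card (turan_part n l j)" for n j
  have i: "i < l" using l by (simp add: i_def)
  have I: "{..<l} = insert i I" "finite I" "i \<notin> I" "card I = l - 1" using i by (auto simp: I_def)
  obtain k where k: "s = Suc k" using rs by (cases s) auto
  have ai: "a (Suc n) i = Suc (a n i)"
  proof -
    have "turan_part (Suc n) l i = insert n (turan_part n l i)"
      by (auto simp: turan_part_def less_Suc_eq i_def)
    moreover have "finite (turan_part n l i)" "n \<notin> turan_part n l i" by (auto simp: turan_part_def)
    ultimately show ?thesis by (simp add: a_def)
  qed
  have "turan_part (Suc n) l j = turan_part n l j" if "j \<in> I" for j
    using that by (auto simp: turan_part_def less_Suc_eq i_def I_def)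
  then have aI: "esym I (a (Suc n)) p = esym I (a n) p" for p by (intro esym_cong) (simp add: a_def)
  have "((l - 1) choose k) * (n div l) ^ k \<le> esym I (a n) k"
    unfolding I(4)[symmetric] by (rule esym_ge_power[OF I(2)]) (auto simp: a_def card_turan_part I_def)
  moreover have "card (hcliques r s (turan_rgraph r p l)) = esym I (a p) (Suc k) + a p i * esym I (a p) k" for p
  proof -
    have "a p = (\<lambda>j. card (turan_part p l j))" by (simp add: a_def fun_eq_iff)
    then show ?thesis
      using card_hcliques_turan_rgraph[OF assms, of p] I(2,3) by (simp add: I(1) k esym_insert)
  qed
  ultimately show ?thesis by (simp add: k aI ai)
qed

text \<open>Any two vertices of a clique share an edge, so cliques are transversals of
  \<open>f\<close>; balancing the parts then reaches the Turan count.\<close>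

lemma card_hcliques_l_partite_le:
  assumes G: "rgraph r G" and rs: "2 \<le> r" "r \<le> s" and l: "l > 0"
    and f: "f ` verts G \<subseteq> {..<l}" "\<forall>e\<in>hedges G. inj_on f e"
  shows "card (hcliques r s G) \<le> card (hcliques r s (turan_rgraph r (card (verts G)) l))"
proof -
  have finV: "finite (verts G)" using G by (simp add: rgraph_def)
  let ?n = "card (verts G)"
  have "hcliques r s G \<subseteq> transversals f (verts G) s"
  proof
    fix S assume S: "S \<in> hcliques r s G"
    then have SV: "S \<subseteq> verts G" "card S = s" "finite S" using finV
      by (auto simp: hcliques_def dest: finite_subset)
    have "inj_on f S"
    proof (rule inj_onI, rule ccontr)
      fix x y assume xy: "x \<in> S" "y \<in> S" "f x = f y" "x \<noteq> y"
      then obtain e where e: "e \<subseteq> S" "card e = r" "x \<in> e" "y \<in> e"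
        using subset_of_card_containing_pair[of S x y r] SV rs by auto
      then have "e \<in> hedges G" using S by (auto simp: hcliques_def)
      then show False using f(2) e xy by (auto simp: inj_on_def)
    qed
    then show "S \<in> transversals f (verts G) s" using SV by (simp add: transversals_def)
  qed
  then have "card (hcliques r s G) \<le> card (transversals f (verts G) s)"
    using finV by (intro card_mono finite_transversals)
  also have "\<dots> = esym {..<l} (\<lambda>i. card {v \<in> verts G. f v = i}) s"
    using finV f by (intro card_transversals) auto
  also have "\<dots> \<le> esym {..<l} (\<lambda>i. card (turan_part ?n l i)) s"
  proof (rule esym_le_balanced)
    have "(\<lambda>v. v mod l) ` {..<?n} \<subseteq> {..<l}" using l by auto
    then have "(\<Sum>i<l. card (turan_part ?n l i)) = ?n"
      using sum_card_fibres[of "{..<?n}" "{..<l}" "\<lambda>v. v mod l"] by (simp add: turan_part_def)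
    then show "(\<Sum>i<l. card {v \<in> verts G. f v = i}) = (\<Sum>i<l. card (turan_part ?n l i))"
      using sum_card_fibres[OF finV _ f(1)] by simp
  qed (auto intro: turan_parts_balanced[THEN order_trans])
  finally show ?thesis by (simp add: card_hcliques_turan_rgraph[OF l rs])
qed

section \<open>Vertex deletion and the descent of the excess\<close>

definition delete_vertex :: "'a \<Rightarrow> 'a hypergraph \<Rightarrow> 'a hypergraph" where
  "delete_vertex v G = HG (verts G - {v}) {e \<in> hedges G. v \<notin> e}"

lemma rgraph_delete_vertex: "rgraph r G \<Longrightarrow> rgraph r (delete_vertex v G)"
  by (auto simp: rgraph_def delete_vertex_def)

lemma hg_free_delete_vertex: "hg_free F G \<Longrightarrow> hg_free F (delete_vertex v G)"
  by (auto simp: hg_free_def copies_def subhypergraph_def delete_vertex_def)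

lemma card_hcliques_delete_vertex:
  assumes "rgraph r G"
  shows "card (hcliques r s G) = card (hcliques r s (delete_vertex v G)) + card {S \<in> hcliques r s G. v \<in> S}"
proof -
  have "hcliques r s (delete_vertex v G) = {S \<in> hcliques r s G. v \<notin> S}"
    by (auto simp: hcliques_def delete_vertex_def)
  moreover have "hcliques r s G = {S \<in> hcliques r s G. v \<notin> S} \<union> {S \<in> hcliques r s G. v \<in> S}" by auto
  then have "card (hcliques r s G) = card {S \<in> hcliques r s G. v \<notin> S} + card {S \<in> hcliques r s G. v \<in> S}"
    using finite_hcliques[OF assms, of s] by (metis (no_types, lifting) card_Un_disjoint
      disjoint_iff finite_Un mem_Collect_eq)
  ultimately show ?thesis by simp
qed

text \<open>The subtraction is truncated, so this yields zero as soon as \<open>k \<ge> x N\<close>,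
  and the alternative \<open>x (Suc n) = 0\<close> fits the same bound.\<close>

lemma decreasing_excess:
  fixes x :: "nat \<Rightarrow> nat"
  assumes "\<And>n. n \<ge> N \<Longrightarrow> x (Suc n) = 0 \<or> Suc (x (Suc n)) \<le> x n"
  shows "x (N + k) \<le> x N - k"
proof (induction k)
  case (Suc k)
  then show ?case using assms[of "N + k"] by auto
qed simp

theorem theorem2p2:
  fixes l s r :: nat
  assumes "l \<ge> s" and "s \<ge> r" and "r \<ge> 3"
  shows "\<exists>n0. \<forall>n\<ge>n0.
    ex_copies r n (complete_rgraph r s) (expansion r (complete_rgraph 2 (l + 1)))
      = num_copies (complete_rgraph r s) (turan_rgraph r n l)"
proof -
  let ?F = "expansion r (complete_rgraph 2 (Suc l))"
  define t where "t n = card (hcliques r s (turan_rgraph r n l))" for n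
  define ex where "ex n = ex_copies r n (complete_rgraph r s) ?F" for n
  define A where "A n = {num_copies (complete_rgraph r s) G | G :: nat hypergraph.
    rgraph r G \<and> card (verts G) = n \<and> hg_free ?F G}" for n
  have l0: "l > 0" and r2: "2 \<le> r" using assms by auto
  have ex_A: "ex n = Max (A n)" for n by (simp add: ex_def A_def ex_copies_def)
  have finA: "finite (A n)" for n unfolding A_def by (rule finite_ex_copies_values)
  have tA: "t n \<in> A n" for n
  proof -
    have "t n = num_copies (complete_rgraph r s) (turan_rgraph r n l)"
      by (simp add: t_def num_copies_complete_rgraph[OF rgraph_turan_rgraph])
    moreover have "card (verts (turan_rgraph r n l)) = n" by (simp add: turan_rgraph_def)
    ultimately show ?thesis
      unfolding A_def using rgraph_turan_rgraph[of r n l] hg_free_turan_rgraph[OF l0, of r n] by blast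
  qed
  have t_le: "t n \<le> ex n" for n unfolding ex_A by (rule Max_ge[OF finA tA])
  have le_ex: "card (hcliques r s G) \<le> ex (card (verts G))" if "rgraph r G" "hg_free ?F G" for G :: "nat hypergraph"
  proof -
    have "card (hcliques r s G) \<in> A (card (verts G))"
      unfolding A_def mem_Collect_eq using that by (intro exI[of _ G]) (simp add: num_copies_complete_rgraph)
    then show ?thesis unfolding ex_A by (rule Max_ge[OF finA])
  qed
  have ex_attained: "\<exists>G :: nat hypergraph. rgraph r G \<and> card (verts G) = n \<and> hg_free ?F G \<and> ex n = card (hcliques r s G)" for n
  proof -
    have "Max (A n) \<in> A n" using finA tA by (intro Max_in) auto
    then show ?thesis unfolding ex_A[symmetric] by (auto simp: A_def num_copies_complete_rgraph)
  qed
  obtain n1 where n1: "\<And>G :: nat hypergraph. rgraph r G \<Longrightarrow> n1 \<le> card (verts G) \<Longrightarrow> hg_free ?F G \<Longrightarrow>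
      (\<And>v. v \<in> verts G \<Longrightarrow>
        ((l - 1) choose (s - 1)) * ((card (verts G) - 1) div l) ^ (s - 1) \<le> card {S \<in> hcliques r s G. v \<in> S}) \<Longrightarrow>
      \<exists>f. f ` verts G \<subseteq> {..<l} \<and> (\<forall>e\<in>hedges G. inj_on f e)"
    using l_partite_of_min_clique_degree[OF assms] by blast
  \<comment> \<open>Truncation loses nothing here, because \<open>t_le\<close> gives
    \<open>t n \<le> ex n\<close>.\<close>
  define x where "x n = ex n - t n" for n
  have step: "x (Suc n) = 0 \<or> Suc (x (Suc n)) \<le> x n" if n: "n \<ge> n1" for n
  proof -
    obtain G :: "nat hypergraph" where G: "rgraph r G" "card (verts G) = Suc n" "hg_free ?F G"
      "ex (Suc n) = card (hcliques r s G)" using ex_attained by blast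
    show ?thesis
    proof (cases "\<forall>v\<in>verts G. ((l - 1) choose (s - 1)) * (n div l) ^ (s - 1) \<le> card {S \<in> hcliques r s G. v \<in> S}")
      case True
      then have "\<exists>f. f ` verts G \<subseteq> {..<l} \<and> (\<forall>e\<in>hedges G. inj_on f e)"
        using n G by (intro n1) auto
      then have "ex (Suc n) \<le> t (Suc n)"
        using card_hcliques_l_partite_le[OF G(1) r2 assms(2) l0] G by (auto simp: t_def)
      then show ?thesis by (simp add: x_def)
    next
      case False
      \<comment> \<open>Since \<open>G\<close> has \<open>Suc n\<close> vertices, the threshold in
        terms of \<open>n div l\<close> is exactly the guaranteed gain from \<open>t n\<close> to
        \<open>t (Suc n)\<close>. The strict inequality at \<open>v\<close> makes the excess drop by
        at least one.\<close>
      then obtain v where v: "v \<in> verts G"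
        "card {S \<in> hcliques r s G. v \<in> S} < ((l - 1) choose (s - 1)) * (n div l) ^ (s - 1)" by auto
      have "finite (verts G)" using G by (simp add: rgraph_def)
      then have "card (verts (delete_vertex v G)) = n" using v G by (simp add: delete_vertex_def)
      then have "card (hcliques r s (delete_vertex v G)) \<le> ex n"
        using le_ex[of "delete_vertex v G"] G rgraph_delete_vertex hg_free_delete_vertex by metis
      then have "ex (Suc n) < ex n + ((l - 1) choose (s - 1)) * (n div l) ^ (s - 1)"
        using card_hcliques_delete_vertex[OF G(1), of s v] v G(4) by linarith
      moreover have "t n + ((l - 1) choose (s - 1)) * (n div l) ^ (s - 1) \<le> t (Suc n)"
        unfolding t_def by (rule card_hcliques_turan_rgraph_Suc[OF l0 r2 assms(2)])
      ultimately show ?thesis using t_le[of n] t_le[of "Suc n"] unfolding x_def by linarith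
    qed
  qed
  show ?thesis
  proof (intro exI allI impI)
    \<comment> \<open>From \<open>n1\<close> on the excess falls by at least one per step until it
      reaches zero, so \<open>x n1\<close> further steps suffice.\<close>
    fix n assume n: "n \<ge> n1 + x n1"
    have "x (n1 + (n - n1)) \<le> x n1 - (n - n1)" by (rule decreasing_excess) (rule step)
    then have "x n = 0" using n by simp
    then have "ex n = t n" using t_le[of n] by (simp add: x_def)
    then show "ex_copies r n (complete_rgraph r s) (expansion r (complete_rgraph 2 (l + 1)))
        = num_copies (complete_rgraph r s) (turan_rgraph r n l)"
      by (simp add: ex_def t_def num_copies_complete_rgraph[OF rgraph_turan_rgraph])
  qed
qed

end
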